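(* Let $x\in\mathbb{C}\setminus\{-it: t\ge 0\}$ and put $y=-ix/\pi$ and $e_k=\mathrm{e}^{-i\pi 2^{-k}}$ for $k\ge1$. Then $$\mathrm{e}^{-x}\,\mathrm{Ei}^+(x)= -\sum_{m=1}^{\infty}\frac{\Gamma(m)}{2^m}\,\frac{1}{(y)_m}+\sum_{k=1}^\infty\left(\sum_{m=1}^\infty\frac{\Gamma(m)\, e_k}{(1+e_k)^m}\,\frac{1}{(2^ky)_m}\right),$$ where all the series converge, and each of the series in $m$ converges geometrically (i.e. for each of them there is $\rho\in(0,1)$ such that the $m$-th term is $O(\rho^m)$ as $m\to\infty$).
   Context: $(z)_m=z(z+1)\cdots(z+m-1)=\Gamma(z+m)/\Gamma(z)$ is the rising factorial (Pochhammer symbol). The function $\mathrm{e}^{-x}\mathrm{Ei}^+(x)$ is defined for $x$ in the open first quadrant by $$\mathrm{e}^{-x}\mathrm{Ei}^+(x)=\int_0^{\infty-i0}\frac{\mathrm{e}^{-px}}{1-p}\,dp,$$ where the path of integration goes from $0$ to $+\infty$ passing below the pole $p=1$ (e.g. the segment $[0,-i]$ followed by the half-line $-i+\mathbb{R}^+$), and it is continued analytically to the cut plane $\mathbb{C}\setminus\{-it: t\ge0\}$. *)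

theory Defs
  imports "HOL-Complex_Analysis.Complex_Analysis" "HOL-Library.Landau_Symbols"
begin

text \<open>
  The integral of \<open>exp (-p x) / (1 - p)\<close> from \<open>0\<close> to \<open>+\<infinity>\<close>, taken along the segment
  from \<open>0\<close> to \<open>-i\<close> followed by the half-line \<open>-i + t\<close>, \<open>t \<ge> 0\<close>. The path passes below
  the pole \<open>p = 1\<close>; the integral converges absolutely for \<open>Re x > 0\<close>.
\<close>

definition exp_Ei_plus_integral :: "complex \<Rightarrow> complex" where
  "exp_Ei_plus_integral x =
     contour_integral (linepath 0 (-\<i>)) (\<lambda>p. exp (-p * x) / (1 - p)) +
     integral {0..} (\<lambda>t::real. exp (-(-\<i> + of_real t) * x) / (1 - (-\<i> + of_real t)))"

definition cut_plane :: "complex set" where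
  "cut_plane = UNIV - {-\<i> * of_real t | t::real. t \<ge> 0}"

text \<open>
  The function \<open>exp (-x) Ei\<^sup>+(x)\<close> as an analytic continuation from the open first quadrant.
  Its values outside the cut plane are unspecified; on the cut plane they are determined
  uniquely, as lemma \<open>exp_Ei_plus_continuation_unique\<close> shows.
\<close>

definition is_exp_Ei_plus_continuation :: "(complex \<Rightarrow> complex) \<Rightarrow> bool" where
  "is_exp_Ei_plus_continuation F \<longleftrightarrow>
     F holomorphic_on cut_plane \<and>
     (\<forall>x. Re x > 0 \<and> Im x > 0 \<longrightarrow> F x = exp_Ei_plus_integral x)"

definition exp_Ei_plus :: "complex \<Rightarrow> complex" where
  "exp_Ei_plus = (SOME F. is_exp_Ei_plus_continuation F)"

lemma mem_cut_plane_iff: "z \<in> cut_plane \<longleftrightarrow> \<not> (Re z = 0 \<and> Im z \<le> 0)"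
proof -
  have "(\<exists>t::real. z = -\<i> * of_real t \<and> t \<ge> 0) \<longleftrightarrow> Re z = 0 \<and> Im z \<le> 0"
    by (auto simp: complex_eq_iff intro: exI[of _ "- Im z"])
  thus ?thesis by (simp add: cut_plane_def)
qed

lemma cut_plane_eq_image: "cut_plane = (*) \<i> ` (- (complex_of_real ` {..0}))"
proof (intro set_eqI iffI)
  fix z assume "z \<in> cut_plane"
  hence "-\<i> * z \<in> - (complex_of_real ` {..0})"
    by (auto simp: mem_cut_plane_iff complex_slot_left_eq)
  thus "z \<in> (*) \<i> ` (- (complex_of_real ` {..0}))"
    by (rule rev_image_eqI) simp
qed (auto simp: mem_cut_plane_iff complex_slot_left_eq)

lemma open_cut_plane: "open cut_plane"
proof -
  have "closed {z. Re z = 0 \<and> Im z \<le> 0}"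
    by (intro closed_Collect_conj closed_Collect_eq closed_Collect_le continuous_intros)
  moreover have "cut_plane = - {z. Re z = 0 \<and> Im z \<le> 0}"
    by (auto simp: mem_cut_plane_iff)
  ultimately show ?thesis by (metis open_Compl)
qed

lemma connected_cut_plane: "connected cut_plane"
proof -
  have "connected (- (complex_of_real ` {..0}))"
    by (rule starlike_imp_connected[OF starlike_slotted_complex_plane_left])
  moreover have "continuous_on (- (complex_of_real ` {..0})) ((*) \<i>)"
    by (intro continuous_intros)
  ultimately show ?thesis
    unfolding cut_plane_eq_image by (rule connected_continuous_image[rotated])
qed

lemma exp_Ei_plus_continuation_unique:
  assumes F: "is_exp_Ei_plus_continuation F" and G: "is_exp_Ei_plus_continuation G"
    and x: "x \<in> cut_plane"
  shows "F x = G x"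
proof (rule analytic_continuation_open[where f = F and g = G])
  show "open {z. Re z > 0 \<and> Im z > 0}"
    by (intro open_Collect_conj open_halfspace_Re_gt open_halfspace_Im_gt)
  have "1 + \<i> \<in> {z. Re z > 0 \<and> Im z > 0}" by simp
  thus "{z. Re z > 0 \<and> Im z > 0} \<noteq> {}" by blast
  show "{z. Re z > 0 \<and> Im z > 0} \<subseteq> cut_plane"
    by (auto simp: mem_cut_plane_iff)
  show "F holomorphic_on cut_plane" "G holomorphic_on cut_plane"
    using F G by (simp_all add: is_exp_Ei_plus_continuation_def)
  show "F z = G z" if "z \<in> {z. Re z > 0 \<and> Im z > 0}" for z
    using F G that by (simp add: is_exp_Ei_plus_continuation_def)
qed (fact open_cut_plane connected_cut_plane x)+

end

theory Submission
  imports Defs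
begin

text \<open>
  With \<open>z = 1 + e\<close>, the series \<open>F(Y) = \<Sum>m\<ge>1. \<Gamma>(m) / (z^m (Y)_m)\<close> satisfies \<open>F(Y + 1) = 1/Y - e F(Y)\<close>.
  Iterating gives \<open>e F(Y) = \<Sum>j\<ge>0. q^j / (Y + j) =: L(q, Y)\<close> with \<open>q = -1/e\<close>, for all \<open>Y\<close> off the poles.
  Splitting even and odd \<open>j\<close> gives \<open>L(-w, 2Y) = L(w^2, Y) - L(w, 2Y)\<close>, so with \<open>w\<^sub>k = exp(i \<pi> / 2^k)\<close>
  the sum over \<open>k\<close> telescopes and the right-hand side becomes \<open>-lim\<^sub>k L(w\<^sub>k, 2^k y)\<close>.
  Summation by parts shows that the convergence is locally uniform on the cut plane, hence the limit is
  holomorphic there. For \<open>Re y > 0\<close>, \<open>L(w\<^sub>k, 2^k y)\<close> is a Laplace integral that converges by dominated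
  convergence to \<open>\<integral>\<^sub>0\<^sup>\<infinity> exp(-y u) / (u - i \<pi>) du\<close>, and rotating the path of integration to the
  negative imaginary axis identifies its negative with the defining integral in the first quadrant.
\<close>

section \<open>Inverse factorial series as Lerch sums\<close>

abbreviation slit_plane :: "complex set" where
  "slit_plane \<equiv> {y. \<not> (Im y = 0 \<and> Re y \<le> 0)}"

text \<open>The Lerch transcendent with exponent 1. It is needed for \<open>norm q = 1\<close>,
  where convergence is only conditional, so the ordered sum \<open>suminf\<close> is
  essential.\<close>

definition lerch :: "complex \<Rightarrow> complex \<Rightarrow> complex" where
  "lerch q Y = (\<Sum>j. q ^ j / (Y + of_nat j))"

text \<open>Successive terms have ratio of norm tending to \<open>1 / norm z < 1\<close>. The index
  is shifted by one: \<open>fact m\<close> is \<Gamma>(m + 1), so \<open>t m\<close> is the term of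
  index \<open>Suc m\<close> in the theorem.\<close>

lemma inverse_factorial_series:
  fixes Y z :: complex
  assumes "\<forall>n. Y \<noteq> - of_nat n" and "norm z > 1"
  defines "t \<equiv> \<lambda>m. fact m / pochhammer Y (Suc m) / z ^ Suc m"
  shows "summable (\<lambda>m. norm (t m))"
    and "\<exists>\<rho>::real. 0 < \<rho> \<and> \<rho> < 1 \<and> (\<lambda>m. norm (t m)) \<in> O(\<lambda>m. \<rho> ^ Suc m)"
proof -
  have *: "summable (\<lambda>m. norm (fact m / pochhammer Y (Suc m) / w ^ Suc m))"
    if w: "norm w > 1" for w :: complex
  proof -
    define u where "u = (\<lambda>m. norm (fact m / pochhammer Y (Suc m) / w ^ Suc m))"
    have ratio: "u (Suc m) = norm (of_nat (Suc m) / (Y + of_nat (Suc m))) / norm w * u m" for m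
      by (simp add: u_def norm_mult norm_divide norm_power pochhammer_Suc[of Y "Suc m"]
           mult_ac del: of_nat_Suc)
    have "(\<lambda>m. of_nat m / (Y + of_nat m)) \<longlonglongrightarrow> 1"
    proof (rule Lim_transform_eventually)
      have "(\<lambda>m. Y / of_nat m) \<longlonglongrightarrow> 0"
        by (rule tendsto_divide_0[OF tendsto_const tendsto_of_nat])
      hence "(\<lambda>m. 1 / (Y / of_nat m + 1)) \<longlonglongrightarrow> 1 / (0 + 1)"
        by (intro tendsto_intros) auto
      thus "(\<lambda>m. 1 / (Y / of_nat m + 1)) \<longlonglongrightarrow> 1" by simp
      show "\<forall>\<^sub>F m in sequentially. 1 / (Y / of_nat m + 1) = of_nat m / (Y + of_nat m)"
        using eventually_gt_at_top[of 0] by eventually_elim (auto simp: field_simps)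
    qed
    hence "(\<lambda>m. norm (of_nat (Suc m) / (Y + of_nat (Suc m)))) \<longlonglongrightarrow> norm (1::complex)"
      by (intro tendsto_norm LIMSEQ_Suc)
    hence "(\<lambda>m. norm (of_nat (Suc m) / (Y + of_nat (Suc m))) / norm w) \<longlonglongrightarrow> 1 / norm w"
      using w by (intro tendsto_intros) auto
    moreover have "1 / norm w < 1" using w by (subst divide_less_eq_1_pos) linarith+
    then obtain c where c: "1 / norm w < c" "c < 1" by (auto dest: dense)
    ultimately have "\<forall>\<^sub>F m in sequentially.
        norm (of_nat (Suc m) / (Y + of_nat (Suc m))) / norm w < c"
      by (metis order_tendstoD(2))
    then obtain N where N: "\<And>m. m \<ge> N \<Longrightarrow>
        norm (of_nat (Suc m) / (Y + of_nat (Suc m))) / norm w < c"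
      by (auto simp: eventually_sequentially)
    show ?thesis unfolding u_def[symmetric]
    proof (rule summable_ratio_test[OF c(2)])
      fix m assume "N \<le> m"
      have "u m \<ge> 0" by (simp add: u_def)
      hence "u (Suc m) \<le> c * u m"
        using N[OF \<open>N \<le> m\<close>] unfolding ratio by (intro mult_right_mono) auto
      thus "norm (u (Suc m)) \<le> c * norm (u m)" using \<open>u m \<ge> 0\<close> by (simp add: u_def)
    qed
  qed
  show "summable (\<lambda>m. norm (t m))" unfolding t_def by (rule *[OF assms(2)])
  \<comment> \<open>Dividing \<open>z\<close> by \<open>r\<close> leaves a number of norm
    \<open>r > 1\<close>, so the ratio test still applies. The factor gained gives the geometric
    rate \<rho> = \<open>1 / r\<close>.\<close>
  define r where "r = sqrt (norm z)"
  have r: "r > 1" "r * r = norm z" using assms(2) by (auto simp: r_def)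
  have "norm (z / of_real r) = r"
    using r by (simp add: norm_divide flip: r(2))
  hence "norm (z / of_real r) > 1" using r(1) by simp
  from *[OF this] have "(\<lambda>m. norm (fact m / pochhammer Y (Suc m) / (z / of_real r) ^ Suc m)) \<longlonglongrightarrow> 0"
    by (rule summable_LIMSEQ_zero)
  moreover have "norm (fact m / pochhammer Y (Suc m) / (z / of_real r) ^ Suc m)
      = norm (t m) / (1 / r) ^ Suc m" for m
    using r unfolding t_def norm_divide norm_power norm_of_real r(2)[symmetric]
    by (simp add: power_mult_distrib power_one_over)
  ultimately have lim: "(\<lambda>m. norm (t m) / (1 / r) ^ Suc m) \<longlonglongrightarrow> 0" by simp
  have "(\<lambda>m. norm (t m)) \<in> O(\<lambda>m. (1 / r) ^ Suc m)"
    by (rule landau_o.small_imp_big, rule smalloI_tendsto[OF lim]) (use r in auto)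
  thus "\<exists>\<rho>::real. 0 < \<rho> \<and> \<rho> < 1 \<and> (\<lambda>m. norm (t m)) \<in> O(\<lambda>m. \<rho> ^ Suc m)"
    using r by (intro exI[of _ "1 / r"]) auto
qed

text \<open>Termwise, the series at \<open>Y + 1\<close> has the terms
  \<open>t m - z * t (Suc m)\<close>. Summing and using \<open>z * t 0 = 1 / Y\<close> gives the
  recurrence.\<close>

lemma inverse_factorial_series_shift:
  fixes Y z :: complex
  assumes Y: "\<forall>n. Y \<noteq> - of_nat n" and z: "norm z > 1"
  defines "F \<equiv> \<lambda>Y. \<Sum>m. fact m / pochhammer Y (Suc m) / z ^ Suc m"
  shows "F (Y + 1) = 1 / Y - (z - 1) * F Y"
proof -
  define t where "t = (\<lambda>m. fact m / pochhammer Y (Suc m) / z ^ Suc m)"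
  have st: "summable t"
    unfolding t_def by (rule summable_norm_cancel, rule inverse_factorial_series(1)[OF Y z])
  have ne: "Y + of_nat n \<noteq> 0" for n
    using Y by (metis add_eq_0_iff2)
  have z0: "z \<noteq> 0" using z by auto
  have "fact m / pochhammer (Y + 1) (Suc m) / z ^ Suc m = t m - z * t (Suc m)" for m
  proof -
    have p: "pochhammer (Y + 1) m \<noteq> 0"
      using ne[of "Suc _"] by (auto simp: pochhammer_eq_0_iff add_ac eq_neg_iff_add_eq_0)
    have "pochhammer Y (Suc (Suc m)) = Y * (pochhammer (Y + 1) m * (Y + 1 + of_nat m))"
      unfolding pochhammer_rec[of Y "Suc m"] pochhammer_Suc[of "Y + 1" m] ..
    moreover have "pochhammer Y (Suc m) = Y * pochhammer (Y + 1) m"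
      by (rule pochhammer_rec)
    moreover have "pochhammer (Y + 1) (Suc m) = pochhammer (Y + 1) m * (Y + 1 + of_nat m)"
      by (rule pochhammer_Suc)
    moreover have "Y + 1 + of_nat m \<noteq> 0" using ne[of "Suc m"] by (simp add: add_ac)
    moreover have "Y \<noteq> 0" using ne[of 0] by simp
    ultimately show ?thesis using p z0 unfolding t_def
      by (simp add: divide_simps) (simp add: algebra_simps)
  qed
  hence "F (Y + 1) = (\<Sum>m. t m - z * t (Suc m))" by (simp add: F_def)
  also have "\<dots> = (\<Sum>m. t m) - z * (\<Sum>m. t (Suc m))"
  proof -
    have st': "summable (\<lambda>m. t (Suc m))" using st by (simp only: summable_Suc_iff)
    show ?thesis
      unfolding suminf_mult[OF st', symmetric] by (rule suminf_diff[OF st summable_mult[OF st'], symmetric])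
  qed
  also have "(\<Sum>m. t (Suc m)) = (\<Sum>m. t m) - t 0"
    using suminf_split_head[OF st] by simp
  also have "z * t 0 = 1 / Y" using z0 by (simp add: t_def)
  hence "(\<Sum>m. t m) - z * ((\<Sum>m. t m) - t 0) = 1 / Y - (z - 1) * (\<Sum>m. t m)"
    by (simp add: algebra_simps)
  finally show ?thesis by (simp add: F_def t_def)
qed

text \<open>Since \<open>norm (Y + of_nat j) \<ge> j\<close>, the Pochhammer symbol outgrows
  \<open>Re Y * fact m\<close>, which leaves a geometric series. The factor \<open>1 / Re Y\<close>
  is what makes the remainder vanish when the recurrence is iterated.\<close>

lemma inverse_factorial_series_bound:
  fixes Y z :: complex
  assumes Y: "Re Y > 0" and z: "norm z > 1"
  shows "norm (\<Sum>m. fact m / pochhammer Y (Suc m) / z ^ Suc m) \<le> 1 / Re Y * (1 / (norm z - 1))"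
proof -
  have poch: "Re Y * fact m \<le> norm (pochhammer Y (Suc m))" for m
  proof (induction m)
    case 0
    show ?case by (simp add: complex_Re_le_cmod)
  next
    case (Suc m)
    have "real (Suc m) \<le> norm (Y + of_nat (Suc m))"
      by (rule order_trans[OF _ complex_Re_le_cmod]) (use Y in simp)
    hence "(Re Y * fact m) * real (Suc m) \<le> norm (pochhammer Y (Suc m)) * norm (Y + of_nat (Suc m))"
      using Suc.IH Y by (intro mult_mono) auto
    thus ?case by (simp add: pochhammer_Suc[of Y "Suc m"] norm_mult mult_ac)
  qed
  have bd: "norm (fact m / pochhammer Y (Suc m) / z ^ Suc m) \<le> 1 / Re Y * (1 / norm z) ^ Suc m" for m
  proof -
    have "fact m / norm (pochhammer Y (Suc m)) \<le> fact m / (Re Y * fact m)"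
      using poch[of m] Y
      by (intro divide_left_mono mult_pos_pos less_le_trans[OF _ poch]) simp_all
    also have "\<dots> = 1 / Re Y" by simp
    finally have "fact m / norm (pochhammer Y (Suc m)) * (1 / norm z) ^ Suc m \<le> 1 / Re Y * (1 / norm z) ^ Suc m"
      by (intro mult_right_mono) auto
    thus ?thesis by (simp add: norm_mult norm_divide norm_power power_divide)
  qed
  have "(\<lambda>m. (1 / norm z) ^ m * (1 / norm z)) sums (1 / (1 - 1 / norm z) * (1 / norm z))"
  proof (intro sums_mult2 geometric_sums)
    show "norm (1 / norm z) < 1"
    proof -
      have "0 < norm z" using z by linarith
      thus ?thesis using z by (simp add: divide_less_eq)
    qed
  qed
  also have "1 / (1 - 1 / norm z) * (1 / norm z) = 1 / (norm z - 1)"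
    using less_trans[OF zero_less_one z] z by (simp add: divide_simps)
  finally have *: "(\<lambda>m. 1 / Re Y * (1 / norm z) ^ Suc m) sums (1 / Re Y * (1 / (norm z - 1)))"
    unfolding power_Suc2 by (rule sums_mult)
  from * have "norm (\<Sum>m. fact m / pochhammer Y (Suc m) / z ^ Suc m) \<le> (\<Sum>m. 1 / Re Y * (1 / norm z) ^ Suc m)"
    by (intro norm_suminf_le bd sums_summable)
  thus ?thesis using * by (simp only: sums_unique[symmetric])
qed

lemma inverse_factorial_series_sums:
  fixes Y e :: complex
  assumes Y: "\<forall>n. Y \<noteq> - of_nat n" and e: "norm e = 1" "norm (1 + e) > 1"
  shows "(\<lambda>j. (- 1 / e) ^ j / (Y + of_nat j)) sums
    (\<Sum>m. fact m * e / pochhammer Y (Suc m) / (1 + e) ^ Suc m)"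
proof -
  define F where "F = (\<lambda>Y. \<Sum>m. fact m / pochhammer Y (Suc m) / (1 + e) ^ Suc m)"
  define q where "q = - 1 / e"
  have e0: "e \<noteq> 0" using e by auto
  have q: "norm q = 1" using e unfolding q_def by (subst norm_divide) simp
  have Yn: "\<forall>n. Y + of_nat N \<noteq> - of_nat n" for N
  proof
    fix n
    show "Y + of_nat N \<noteq> - of_nat n"
      using Y[rule_format, of "N + n"] by (auto simp: algebra_simps eq_neg_iff_add_eq_0)
  qed
  have shift: "F (Y + of_nat (Suc N)) = 1 / (Y + of_nat N) - e * F (Y + of_nat N)" for N
    using inverse_factorial_series_shift[OF Yn e(2), of N] by (simp add: F_def add_ac)
  \<comment> \<open>Each use of the recurrence splits off one Lerch term and multiplies the
    remainder by \<open>q\<close>, which has norm 1.\<close>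
  have partial: "e * F Y = (\<Sum>j<N. q ^ j / (Y + of_nat j)) + q ^ N * (e * F (Y + of_nat N))" for N
  proof (induction N)
    case (Suc N)
    have "q * (e * F (Y + of_nat (Suc N))) = e * F (Y + of_nat N) - 1 / (Y + of_nat N)"
      using e0 unfolding shift q_def by (simp add: field_simps)
    hence "q ^ Suc N * (e * F (Y + of_nat (Suc N))) = q ^ N * (e * F (Y + of_nat N) - 1 / (Y + of_nat N))"
      by (simp only: power_Suc2 mult.assoc)
    also have "\<dots> = q ^ N * (e * F (Y + of_nat N)) - q ^ N / (Y + of_nat N)"
      by (simp add: right_diff_distrib)
    finally have "(\<Sum>j<Suc N. q ^ j / (Y + of_nat j)) + q ^ Suc N * (e * F (Y + of_nat (Suc N)))
        = (\<Sum>j<N. q ^ j / (Y + of_nat j)) + q ^ N * (e * F (Y + of_nat N))"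
      by simp
    thus ?case using Suc.IH by metis
  qed simp
  have "(\<lambda>N. q ^ N * (e * F (Y + of_nat N))) \<longlonglongrightarrow> 0"
  proof (rule Lim_null_comparison)
    \<comment> \<open>The bound requires a positive real part. \<open>Y\<close> itself need not have
      one, but \<open>Y + of_nat N\<close> does for all large \<open>N\<close>.\<close>
    obtain N0 :: nat where N0: "real N0 > - Re Y" using reals_Archimedean2 by blast
    show "\<forall>\<^sub>F N in sequentially. norm (q ^ N * (e * F (Y + of_nat N)))
        \<le> 1 / (Re Y + real N) * (1 / (norm (1 + e) - 1))"
      using eventually_ge_at_top[of N0]
    proof eventually_elim
      case (elim N)
      hence "Re (Y + of_nat N) > 0" using N0 by simp
      from inverse_factorial_series_bound[OF this e(2)] show ?case
        using q e by (simp add: F_def norm_mult norm_power)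
    qed
    have "(\<lambda>N. 1 / (Re Y + real N)) \<longlonglongrightarrow> 0" by real_asymp
    from tendsto_mult_left_zero[OF this]
    show "(\<lambda>N. 1 / (Re Y + real N) * (1 / (norm (1 + e) - 1))) \<longlonglongrightarrow> 0" .
  qed
  hence "(\<lambda>N. e * F Y - q ^ N * (e * F (Y + of_nat N))) \<longlonglongrightarrow> e * F Y - 0"
    by (intro tendsto_intros)
  moreover have "(\<lambda>N. e * F Y - q ^ N * (e * F (Y + of_nat N))) = (\<lambda>N. \<Sum>j<N. q ^ j / (Y + of_nat j))"
    using partial by (auto simp: fun_eq_iff algebra_simps)
  ultimately have "(\<lambda>j. q ^ j / (Y + of_nat j)) sums (e * F Y)"
    by (simp add: sums_def)
  also have "e * F Y = (\<Sum>m. e * (fact m / pochhammer Y (Suc m) / (1 + e) ^ Suc m))"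
    unfolding F_def
    by (rule suminf_mult[symmetric], rule summable_norm_cancel, rule inverse_factorial_series(1)[OF Y e(2)])
  finally show ?thesis by (simp add: q_def mult_ac)
qed

section \<open>Lerch sums on the slit plane\<close>

text \<open>
  A lower bound that passes from \<open>y\<close> to \<open>2^k y\<close> with the same \<open>c\<close> and with \<open>R\<close> growing like \<open>2^k\<close>;
  this is where the geometric decay in \<open>k\<close> comes from.
\<close>

definition away :: "real \<Rightarrow> real \<Rightarrow> complex \<Rightarrow> bool" where
  "away c R Y \<longleftrightarrow> (\<forall>s\<ge>0. c * (R + s) \<le> norm (Y + of_real s))"

lemma awayD: "away c R Y \<Longrightarrow> s \<ge> 0 \<Longrightarrow> c * (R + s) \<le> norm (Y + of_real s)"
  by (simp add: away_def)

lemma away_of_nat: "away c R Y \<Longrightarrow> c * (R + real n) \<le> norm (Y + of_nat n)"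
  using awayD[of c R Y "real n"] by simp

lemma away_nonzero:
  assumes "away c R Y" "c > 0" "R > 0"
  shows "Y + of_nat n \<noteq> 0"
proof
  assume "Y + of_nat n = 0"
  with away_of_nat[OF assms(1), of n] have "c * (R + real n) \<le> 0" by simp
  moreover have "c * (R + real n) > 0" using assms(2,3) by (intro mult_pos_pos) auto
  ultimately show False by linarith
qed

lemma away_scale:
  assumes "away c R Y" "h > 0"
  shows "away c (h * R) (of_real h * Y)"
  unfolding away_def
proof (intro allI impI)
  fix s :: real assume "s \<ge> 0"
  hence "c * (R + s / h) \<le> norm (Y + of_real (s / h))"
    using assms by (intro awayD) auto
  hence "h * (c * (R + s / h)) \<le> h * norm (Y + of_real (s / h))"
    using assms by simp
  also have "h * norm (Y + of_real (s / h)) = norm (of_real h * (Y + of_real (s / h)))"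
    using assms by (simp add: norm_mult)
  also have "of_real h * (Y + of_real (s / h)) = of_real h * Y + of_real s"
    using assms by (simp add: distrib_left)
  also have "h * (c * (R + s / h)) = c * (h * R + s)"
    using assms by (simp add: field_simps)
  finally show "c * (h * R + s) \<le> norm (of_real h * Y + of_real s)" .
qed

text \<open>With \<open>c\<close> the cosine of a half angle, \<open>2 * c ^ 2 - 1\<close> is the
  cosine of the full angle, so the first hypothesis places \<open>y\<close> in a sector around the
  positive axis.\<close>

lemma away_sector:
  assumes "Re y \<ge> (2 * c ^ 2 - 1) * norm y" "norm y \<ge> R" "R > 0" "c > 0"
  shows "away c R y"
  unfolding away_def
proof (intro allI impI)
  fix s :: real assume s: "s \<ge> 0"
  define r where "r = norm y"
  have r: "r > 0" "r \<ge> R" using assms by (auto simp: r_def)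
  have "(2 * c ^ 2 - 1) * r \<le> 1 * r"
    using assms(1) complex_Re_le_cmod[of y] unfolding r_def by linarith
  hence c1: "c ^ 2 \<le> 1" using r by simp
  \<comment> \<open>The added square completes the identity r^2 + s^2 + 2 s r (2 c^2 - 1) = c^2 (r +
    s)^2 + (1 - c^2) (r - s)^2.\<close>
  have "(c * (r + s)) ^ 2 \<le> (c * (r + s)) ^ 2 + (1 - c ^ 2) * (r - s) ^ 2"
    using c1 by simp
  also have "\<dots> = r ^ 2 + s ^ 2 + 2 * s * ((2 * c ^ 2 - 1) * r)"
    by (simp add: power2_eq_square algebra_simps)
  also have "\<dots> \<le> r ^ 2 + s ^ 2 + 2 * s * Re y"
    using assms(1) s by (intro add_left_mono mult_left_mono) (auto simp: r_def)
  also have "\<dots> = norm (y + of_real s) ^ 2"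
    unfolding r_def cmod_power2 by (simp add: power2_eq_square algebra_simps)
  finally have "c * (r + s) \<le> norm (y + of_real s)"
    by (rule power2_le_imp_le) simp
  moreover have "c * (R + s) \<le> c * (r + s)" using r assms by simp
  ultimately show "c * (R + s) \<le> norm (y + of_real s)" by linarith
qed

section \<open>Topology of the slit plane and local uniformity of \<open>away\<close>\<close>

lemma open_slit_plane: "open slit_plane"
proof -
  have "closed {z. Im z = 0 \<and> Re z \<le> 0}"
    by (intro closed_Collect_conj closed_Collect_eq closed_Collect_le continuous_intros)
  moreover have "slit_plane = - {z. Im z = 0 \<and> Re z \<le> 0}" by auto
  ultimately show ?thesis by (metis open_Compl)
qed

text \<open>Off the slit \<open>norm y0 + Re y0\<close> is positive, so the sector and size
  conditions of \<open>away_sector\<close> hold strictly at \<open>y0\<close> for small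
  \<open>c\<close>. Being open conditions, they persist on a closed ball. One constant serves as
  both \<open>c\<close> and \<open>R\<close>.\<close>

lemma slit_plane_locally_away:
  assumes "y0 \<in> slit_plane"
  obtains c d where "c > 0" "d > 0" "cball y0 d \<subseteq> slit_plane" "\<And>y. y \<in> cball y0 d \<Longrightarrow> away c c y"
proof -
  define g where "g = norm y0 + Re y0"
  have y0: "norm y0 > 0" using assms by auto
  have "g > 0"
  proof (rule ccontr)
    assume "\<not> g > 0"
    hence "norm y0 \<le> - Re y0" by (simp add: g_def)
    hence "norm y0 ^ 2 \<le> (- Re y0) ^ 2" by (intro power_mono) auto
    hence "Im y0 = 0" by (simp add: cmod_power2)
    moreover have "Re y0 \<le> 0" using \<open>norm y0 \<le> - Re y0\<close> norm_ge_zero[of y0] by linarith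
    ultimately show False using assms by simp
  qed
  \<comment> \<open>The first entry ensures \<open>c < norm y0\<close>, the second
    \<open>2 * c ^ 2 * norm y0 \<le> g / 2 < g\<close>.\<close>
  define c where "c = min (norm y0 / 2) (sqrt (g / (4 * norm y0)))"
  have "c > 0" using y0 \<open>g > 0\<close> by (simp add: c_def)
  moreover have "c \<le> norm y0 / 2" by (simp add: c_def)
  ultimately have c: "c > 0" "c < norm y0" using y0 by linarith+
  have "c ^ 2 \<le> sqrt (g / (4 * norm y0)) ^ 2"
    using c by (intro power_mono) (auto simp: c_def)
  also have "\<dots> = g / (4 * norm y0)" using \<open>g > 0\<close> by simp
  finally have "2 * c ^ 2 * norm y0 \<le> 2 * (g / (4 * norm y0)) * norm y0"
    using y0 by (intro mult_right_mono mult_left_mono) auto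
  also have "\<dots> < g" using y0 \<open>g > 0\<close> by simp
  finally have c2: "2 * c ^ 2 * norm y0 < norm y0 + Re y0" by (simp add: g_def)
  define U where "U = slit_plane \<inter> {y. c < norm y} \<inter> {y. 2 * c ^ 2 * norm y < norm y + Re y}"
  have "open U" unfolding U_def
    by (intro open_Int open_slit_plane open_Collect_less continuous_intros)
  moreover have "y0 \<in> U" using c c2 assms by (simp add: U_def)
  ultimately obtain d where d: "d > 0" "cball y0 d \<subseteq> U" by (auto simp: open_contains_cball)
  show ?thesis
  proof (rule that[OF c(1) d(1)])
    show "cball y0 d \<subseteq> slit_plane" using d by (auto simp: U_def)
    show "away c c y" if "y \<in> cball y0 d" for y
    proof -
      have "y \<in> U" using that d by blast
      thus ?thesis using c by (intro away_sector) (auto simp: U_def algebra_simps)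
    qed
  qed
qed

text \<open>Multiplying by \<open>1 - q\<close> replaces the weights
  \<open>1 / (Y + of_nat j)\<close> by their differences. The resulting series of \<open>d\<close>
  converges absolutely under a telescoping majorant with sum \<open>1 / (c ^ 2 * R)\<close>, and the
  term \<open>1 / Y\<close> contributes at most \<open>1 / (c * R)\<close>.\<close>

lemma lerch_abel_summation:
  assumes q: "norm q = 1" "q \<noteq> 1" and Y: "away c R Y" "c > 0" "R > 0"
  defines "d \<equiv> \<lambda>j. q ^ Suc j / ((Y + of_nat j) * (Y + of_nat (Suc j)))"
  shows "norm (d j) \<le> 1 / c ^ 2 * (1 / (R + real j) - 1 / (R + real (Suc j)))"
    and "(\<lambda>j. q ^ j / (Y + of_nat j)) sums ((1 / Y - suminf d) / (1 - q))"
    and "norm ((1 / Y - suminf d) / (1 - q)) \<le> (1 / c + 1 / c ^ 2) / R / norm (1 - q)"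
proof -
  have ne: "Y + of_nat j \<noteq> 0" for j using away_nonzero[OF Y] .
  show bd: "norm (d j) \<le> 1 / c ^ 2 * (1 / (R + real j) - 1 / (R + real (Suc j)))" for j
  proof -
    have pos: "R + real i > 0" for i using Y by simp
    have "norm (d j) = 1 / (norm (Y + of_nat j) * norm (Y + of_nat (Suc j)))"
      using q unfolding d_def norm_divide norm_mult norm_power by simp
    also have "\<dots> \<le> 1 / ((c * (R + real j)) * (c * (R + real (Suc j))))"
      using Y pos ne
      by (intro divide_left_mono mult_mono away_of_nat mult_pos_pos mult_nonneg_nonneg)
         (simp_all only: zero_less_norm_iff norm_ge_zero less_imp_le zero_le_one simp_thms)
    also have "\<dots> = 1 / c ^ 2 * (1 / (R + real j) - 1 / (R + real (Suc j)))"
      using pos[of j] pos[of "Suc j"] Y(2) by (simp add: divide_simps power2_eq_square)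
    finally show ?thesis .
  qed
  have "(\<lambda>j. 1 / (R + real j) - 1 / (R + real (Suc j))) sums (1 / (R + real 0) - 0)"
  proof (rule telescope_sums')
    show "(\<lambda>j. 1 / (R + real j)) \<longlonglongrightarrow> 0" by real_asymp
  qed
  hence sums: "(\<lambda>j. 1 / c ^ 2 * (1 / (R + real j) - 1 / (R + real (Suc j)))) sums (1 / c ^ 2 * (1 / R))"
    by (intro sums_mult) simp
  have d: "summable d"
    by (rule summable_comparison_test'[OF sums_summable[OF sums] bd])
  have nd: "norm (suminf d) \<le> 1 / c ^ 2 * (1 / R)"
    using norm_suminf_le[OF bd sums_summable[OF sums]] sums_unique[OF sums] by simp
  have partial: "(1 - q) * (\<Sum>j<N. q ^ j / (Y + of_nat j)) = 1 / Y - (\<Sum>j<N. d j) - q ^ N / (Y + of_nat N)" for N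
  proof (induction N)
    case (Suc N)
    have "(1 - q) * (q ^ N / (Y + of_nat N)) = - d N - q ^ Suc N / (Y + of_nat (Suc N)) + q ^ N / (Y + of_nat N)"
    proof -
      have *: "1 / (A * B) = 1 / A - 1 / B" if "A \<noteq> 0" "B \<noteq> 0" "B = A + 1" for A B :: complex
        using that by (simp add: divide_simps)
      have "d N = q ^ Suc N * (1 / ((Y + of_nat N) * (Y + of_nat (Suc N))))"
        by (simp add: d_def)
      also have "1 / ((Y + of_nat N) * (Y + of_nat (Suc N))) = 1 / (Y + of_nat N) - 1 / (Y + of_nat (Suc N))"
        by (rule *[OF ne ne]) simp
      finally have "d N = q ^ Suc N * (1 / (Y + of_nat N) - 1 / (Y + of_nat (Suc N)))" .
      thus ?thesis by (simp add: left_diff_distrib right_diff_distrib diff_divide_distrib)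
    qed
    thus ?case by (simp add: distrib_left Suc.IH)
  qed (use ne[of 0] in simp)
  have "(\<lambda>N. norm (q ^ N / (Y + of_nat N))) \<longlonglongrightarrow> 0"
  proof (rule Lim_null_comparison)
    show "\<forall>\<^sub>F N in sequentially. norm (norm (q ^ N / (Y + of_nat N))) \<le> 1 / c * (1 / (R + real N))"
    proof (intro always_eventually allI)
      fix N
      have "norm (norm (q ^ N / (Y + of_nat N))) = 1 / norm (Y + of_nat N)"
        using q by (simp add: norm_divide norm_power)
      also have "\<dots> \<le> 1 / (c * (R + real N))"
        using Y ne[of N]
        by (intro divide_left_mono away_of_nat mult_pos_pos add_pos_nonneg) simp_all
      finally show "norm (norm (q ^ N / (Y + of_nat N))) \<le> 1 / c * (1 / (R + real N))" by simp
    qed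
    have "(\<lambda>N. 1 / (R + real N)) \<longlonglongrightarrow> 0" by real_asymp
    thus "(\<lambda>N. 1 / c * (1 / (R + real N))) \<longlonglongrightarrow> 0" by (rule tendsto_mult_right_zero)
  qed
  hence "(\<lambda>N. q ^ N / (Y + of_nat N)) \<longlonglongrightarrow> 0" by (rule tendsto_norm_zero_cancel)
  hence "(\<lambda>N. (1 / Y - (\<Sum>j<N. d j) - q ^ N / (Y + of_nat N)) / (1 - q)) \<longlonglongrightarrow> (1 / Y - suminf d - 0) / (1 - q)"
    using d q by (intro tendsto_intros) (auto simp: sums_def[symmetric] summable_sums)
  moreover have "(1 / Y - (\<Sum>j<N. d j) - q ^ N / (Y + of_nat N)) / (1 - q) = (\<Sum>j<N. q ^ j / (Y + of_nat j))" for N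
    using q unfolding partial[symmetric] by simp
  ultimately show "(\<lambda>j. q ^ j / (Y + of_nat j)) sums ((1 / Y - suminf d) / (1 - q))"
    by (simp add: sums_def)
  have "norm (1 / Y - suminf d) \<le> norm (1 / Y) + norm (suminf d)" by (rule norm_triangle_ineq4)
  also have "norm (1 / Y) \<le> 1 / (c * R)"
    unfolding norm_divide norm_one using away_of_nat[OF Y(1), of 0] Y ne[of 0]
    by (intro divide_left_mono mult_pos_pos) simp_all
  also note nd
  also have "1 / (c * R) + 1 / c ^ 2 * (1 / R) = (1 / c + 1 / c ^ 2) / R"
    using Y by (simp add: add_divide_distrib)
  finally show "norm ((1 / Y - suminf d) / (1 - q)) \<le> (1 / c + 1 / c ^ 2) / R / norm (1 - q)"
    unfolding norm_divide by (intro divide_right_mono) auto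
qed

lemma lerch_sums:
  assumes "norm q = 1" "q \<noteq> 1" "away c R Y" "c > 0" "R > 0"
  shows "(\<lambda>j. q ^ j / (Y + of_nat j)) sums lerch q Y"
  unfolding lerch_def by (rule summable_sums, rule sums_summable, rule lerch_abel_summation(2)[OF assms])

lemma lerch_bound:
  assumes "norm q = 1" "q \<noteq> 1" "away c R Y" "c > 0" "R > 0"
  shows "norm (lerch q Y) \<le> (1 / c + 1 / c ^ 2) / R / norm (1 - q)"
  using lerch_abel_summation(3)[OF assms]
  unfolding sums_unique2[OF lerch_sums[OF assms] lerch_abel_summation(2)[OF assms]] .

section \<open>Holomorphy of Lerch sums\<close>

lemma holomorphic_on_suminf:
  fixes f :: "nat \<Rightarrow> complex \<Rightarrow> complex"
  assumes "open S" "\<And>n. f n holomorphic_on S"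
    and "\<And>x. x \<in> S \<Longrightarrow> \<exists>d M. d > 0 \<and> cball x d \<subseteq> S \<and> summable M \<and> (\<forall>n. \<forall>y\<in>cball x d. norm (f n y) \<le> M n)"
  shows "(\<lambda>y. \<Sum>n. f n y) holomorphic_on S"
proof (rule holomorphic_uniform_sequence[OF assms(1)])
  show "(\<lambda>y. \<Sum>i<n. f i y) holomorphic_on S" for n
    by (intro holomorphic_on_sum assms(2))
  fix x assume "x \<in> S"
  then obtain d M where "d > 0" "cball x d \<subseteq> S" "summable M" "\<forall>n. \<forall>y\<in>cball x d. norm (f n y) \<le> M n"
    using assms(3)[OF \<open>x \<in> S\<close>] by (elim exE conjE) (rule that)
  thus "\<exists>d>0. cball x d \<subseteq> S \<and> uniform_limit (cball x d) (\<lambda>n y. \<Sum>i<n. f i y) (\<lambda>y. \<Sum>n. f n y) sequentially"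
    by (intro exI[of _ d] conjI Weierstrass_m_test[where M = M]) auto
qed

text \<open>The defining series is not absolutely convergent, so the M-test is applied to its form
  after summation by parts, with the telescoping majorant that \<open>away\<close> supplies on a
  ball.\<close>

lemma lerch_holomorphic:
  assumes q: "norm q = 1" "q \<noteq> 1"
  shows "lerch q holomorphic_on slit_plane"
proof -
  have ne: "y + of_nat j \<noteq> 0" if "y \<in> slit_plane" for y j
    using that by (auto simp: complex_eq_iff)
  have "(\<lambda>y. (1 / y - (\<Sum>j. q ^ Suc j / ((y + of_nat j) * (y + of_nat (Suc j))))) / (1 - q)) holomorphic_on slit_plane"
  proof (intro holomorphic_intros holomorphic_on_suminf open_slit_plane)
    show "y \<noteq> 0" if "y \<in> slit_plane" for y using ne[OF that, of 0] by simp
    show "1 - q \<noteq> 0" if "y \<in> slit_plane" for y :: complex using q by simp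
    show "(y + of_nat j) * (y + of_nat (Suc j)) \<noteq> 0" if "y \<in> slit_plane" for y j
      using ne[OF that, of j] ne[OF that, of "Suc j"] by simp
    fix y0 assume "y0 \<in> slit_plane"
    then obtain c d where c: "c > 0" "d > 0" "cball y0 d \<subseteq> slit_plane" "\<And>y. y \<in> cball y0 d \<Longrightarrow> away c c y"
      by (rule slit_plane_locally_away) blast
    define M where "M = (\<lambda>j. 1 / c ^ 2 * (1 / (c + real j) - 1 / (c + real (Suc j))))"
    have "(\<lambda>j. 1 / (c + real j)) \<longlonglongrightarrow> 0" by real_asymp
    from telescope_summable'[OF this] have "summable M"
      unfolding M_def by (rule summable_mult)
    moreover have "norm (q ^ Suc j / ((y + of_nat j) * (y + of_nat (Suc j)))) \<le> M j" if "y \<in> cball y0 d" for y j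
      unfolding M_def by (rule lerch_abel_summation(1)[OF q c(4)[OF that] c(1) c(1)])
    ultimately show "\<exists>d M. d > 0 \<and> cball y0 d \<subseteq> slit_plane \<and> summable M \<and>
        (\<forall>n. \<forall>y\<in>cball y0 d. norm (q ^ Suc n / ((y + of_nat n) * (y + of_nat (Suc n)))) \<le> M n)"
      using c by (intro exI[of _ d] exI[of _ M]) blast
  qed
  moreover have "(1 / y - (\<Sum>j. q ^ Suc j / ((y + of_nat j) * (y + of_nat (Suc j))))) / (1 - q) = lerch q y"
    if "y \<in> slit_plane" for y
  proof -
    from that obtain c d
      where c: "c > 0" "d > 0" "cball y d \<subseteq> slit_plane" "\<And>z. z \<in> cball y d \<Longrightarrow> away c c z"
      by (rule slit_plane_locally_away) blast
    hence "away c c y" by simp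
    from lerch_abel_summation(2)[OF q this c(1) c(1)] show ?thesis
      unfolding lerch_def by (auto simp: sums_iff)
  qed
  ultimately show ?thesis by (rule holomorphic_transform)
qed

lemma lerch_duplication:
  assumes w: "norm w = 1" "w \<noteq> 1" "w \<noteq> - 1" and Y: "away c R Y" "c > 0" "R > 0"
  shows "lerch (- w) (2 * Y) + lerch w (2 * Y) = lerch (w ^ 2) Y"
proof -
  have Y2: "away c (2 * R) (2 * Y)" using away_scale[OF Y(1), of 2] by simp
  have R2: "2 * R > 0" using Y by simp
  have nw: "norm (- w) = 1" "norm (w ^ 2) = 1" "w ^ 2 \<noteq> 1"
    using w by (simp_all add: norm_power power2_eq_1_iff)
  have nw': "- w \<noteq> 1" using w(3) by (metis add.inverse_inverse)
  define s where "s = (\<lambda>j. (- w) ^ j / (2 * Y + of_nat j) + w ^ j / (2 * Y + of_nat j))"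
  have s: "s sums (lerch (- w) (2 * Y) + lerch w (2 * Y))"
    unfolding s_def by (intro sums_add lerch_sums[OF _ _ Y2 Y(2) R2] nw(1) nw' w)
  \<comment> \<open>Only partial sums of even length are compared, since conditional convergence
    forbids rearranging. In \<open>s\<close> the odd terms cancel and the even ones double.\<close>
  hence "(\<lambda>N. \<Sum>j<2 * N. s j) \<longlonglongrightarrow> lerch (- w) (2 * Y) + lerch w (2 * Y)"
    unfolding sums_def
    by (rule filterlim_compose) (rule filterlim_subseq, simp add: strict_mono_def)
  moreover have "(\<Sum>j<2 * N. s j) = (\<Sum>j<N. (w ^ 2) ^ j / (Y + of_nat j))" for N
  proof (induction N)
    case (Suc N)
    have "s (Suc (2 * N)) = 0" by (simp add: s_def)
    moreover have "s (2 * N) = (w ^ 2) ^ N / (Y + of_nat N)"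
    proof -
      have "2 * Y + of_nat (2 * N) = 2 * (Y + of_nat N)" by simp
      moreover have "(- w) ^ (2 * N) = (w ^ 2) ^ N" "w ^ (2 * N) = (w ^ 2) ^ N"
        by (simp_all add: power_mult)
      ultimately have "s (2 * N) = (2 * (w ^ 2) ^ N) / (2 * (Y + of_nat N))"
        unfolding s_def by (simp only: add_divide_distrib[symmetric] mult_2[symmetric] times_divide_eq_right)
      also have "\<dots> = (w ^ 2) ^ N / (Y + of_nat N)"
        by (rule mult_divide_mult_cancel_left) simp
      finally show ?thesis .
    qed
    ultimately show ?case using Suc by simp
  qed simp
  ultimately have "(\<lambda>N. \<Sum>j<N. (w ^ 2) ^ j / (Y + of_nat j)) \<longlonglongrightarrow> lerch (- w) (2 * Y) + lerch w (2 * Y)"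
    by simp
  moreover have "(\<lambda>N. \<Sum>j<N. (w ^ 2) ^ j / (Y + of_nat j)) \<longlonglongrightarrow> lerch (w ^ 2) Y"
    using lerch_sums[OF nw(2,3) Y] by (simp add: sums_def)
  ultimately show ?thesis by (rule LIMSEQ_unique)
qed

section \<open>Dyadic telescoping\<close>

definition root_of_minus_one :: "nat \<Rightarrow> complex" where
  "root_of_minus_one k = cis (pi / 2 ^ k)"

lemma root_of_minus_one_0 [simp]: "root_of_minus_one 0 = - 1"
  by (simp add: root_of_minus_one_def)

lemma norm_root_of_minus_one [simp]: "norm (root_of_minus_one k) = 1"
  by (simp add: root_of_minus_one_def)

lemma root_of_minus_one_Suc_square: "root_of_minus_one (Suc k) ^ 2 = root_of_minus_one k"
  by (simp add: root_of_minus_one_def power2_eq_square cis_mult)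

lemma root_of_minus_one_neq_1: "root_of_minus_one k \<noteq> 1"
proof (induction k)
  case (Suc k)
  thus ?case using root_of_minus_one_Suc_square[of k] by auto
qed simp

text \<open>At index 0 the value is -1, hence the \<open>Suc\<close>. The sign of the real part
  yields \<open>norm (1 + w) > 1\<close>, which gives convergence of the factorial series, bounds
  the factor \<open>1 / norm (1 - q)\<close> at \<open>q = - w\<close>, and excludes
  \<open>w = - 1\<close> in the duplication formula.\<close>

lemma Re_root_of_minus_one_Suc: "Re (root_of_minus_one (Suc k)) \<ge> 0"
proof -
  have "pi / 2 ^ Suc k \<le> pi / 2 ^ 1" by (intro divide_left_mono power_increasing) auto
  hence "pi / 2 ^ Suc k \<le> pi / 2" by simp
  moreover have "pi / 2 ^ Suc k \<ge> 0" by simp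
  ultimately show ?thesis unfolding root_of_minus_one_def by (simp only: cis.simps cos_ge_zero)
qed

lemma norm_one_plus_gt_1:
  assumes "norm w = 1" "Re w \<ge> 0"
  shows "norm (1 + w) > 1"
proof -
  have "norm (1 + w) ^ 2 = 1 + norm w ^ 2 + 2 * Re w"
    unfolding cmod_power2 by (simp add: power2_eq_square algebra_simps)
  hence "norm (1 + w) ^ 2 > 1 ^ 2" using assms by simp
  thus ?thesis by (rule power2_less_imp_less) simp
qed

lemma norm_one_plus_root_of_minus_one_Suc: "norm (1 + root_of_minus_one (Suc k)) > 1"
  by (intro norm_one_plus_gt_1 Re_root_of_minus_one_Suc) simp

lemma root_of_minus_one_Suc_neq_minus_1: "root_of_minus_one (Suc k) \<noteq> - 1"
  using norm_one_plus_root_of_minus_one_Suc[of k] by auto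

text \<open>The right-hand side of the theorem with every series in \<open>m\<close> replaced by its
  Lerch sum. The first series is the case \<open>e = 1\<close>, hence \<open>q = - 1\<close>;
  \<open>Suc k\<close> accounts for the outer sum starting at 1.\<close>

definition dyadic_sum :: "complex \<Rightarrow> complex" where
  "dyadic_sum y = - lerch (- 1) y + (\<Sum>k. lerch (- root_of_minus_one (Suc k)) (2 ^ Suc k * y))"

lemma away_two_power: "away c R y \<Longrightarrow> away c (2 ^ k * R) (2 ^ k * y)"
  using away_scale[of c R y "2 ^ k"] by simp

text \<open>Scaling by \<open>2 ^ Suc k\<close> enlarges \<open>R\<close> by the same factor, and
  here \<open>1 - q = 1 + root_of_minus_one (Suc k)\<close> has norm above 1.\<close>

lemma lerch_dyadic_bound:
  assumes "away c R y" "c > 0" "R > 0"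
  shows "norm (lerch (- root_of_minus_one (Suc k)) (2 ^ Suc k * y)) \<le> (1 / c + 1 / c ^ 2) / R * (1 / 2) ^ Suc k"
proof -
  have "- root_of_minus_one (Suc k) \<noteq> 1"
    using root_of_minus_one_Suc_neq_minus_1[of k] by (metis add.inverse_inverse)
  hence "norm (lerch (- root_of_minus_one (Suc k)) (2 ^ Suc k * y))
      \<le> (1 / c + 1 / c ^ 2) / (2 ^ Suc k * R) / norm (1 - - root_of_minus_one (Suc k))"
    using assms by (intro lerch_bound[OF _ _ away_two_power]) auto
  also have "\<dots> \<le> (1 / c + 1 / c ^ 2) / (2 ^ Suc k * R) / 1"
    using assms norm_one_plus_root_of_minus_one_Suc[of k]
    by (intro divide_left_mono divide_nonneg_nonneg add_nonneg_nonneg) auto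
  also have "\<dots> = (1 / c + 1 / c ^ 2) / R * (1 / 2) ^ Suc k"
    by (simp add: power_one_over field_simps)
  finally show ?thesis .
qed

lemma summable_half_powers: "summable (\<lambda>k. C * (1 / 2 :: real) ^ Suc k)"
proof -
  have "summable (\<lambda>k. (1 / 2 :: real) ^ k)" by (rule summable_geometric) simp
  hence "summable (\<lambda>k. (1 / 2 :: real) ^ Suc k)" by (simp only: summable_Suc_iff)
  thus ?thesis by (rule summable_mult)
qed

lemma summable_lerch_dyadic:
  assumes "away c R y" "c > 0" "R > 0"
  shows "summable (\<lambda>k. lerch (- root_of_minus_one (Suc k)) (2 ^ Suc k * y))"
  by (rule summable_comparison_test'[OF summable_half_powers lerch_dyadic_bound[OF assms]])

lemma dyadic_sum_holomorphic: "dyadic_sum holomorphic_on slit_plane"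
proof -
  have "lerch (- root_of_minus_one (Suc k)) \<circ> (\<lambda>y. 2 ^ Suc k * y) holomorphic_on slit_plane" for k
  proof (rule holomorphic_on_compose_gen)
    have "- root_of_minus_one (Suc k) \<noteq> 1"
      using root_of_minus_one_Suc_neq_minus_1[of k] by (metis add.inverse_inverse)
    thus "lerch (- root_of_minus_one (Suc k)) holomorphic_on slit_plane"
      by (intro lerch_holomorphic) auto
    show "(\<lambda>y. 2 ^ Suc k * y) ` slit_plane \<subseteq> slit_plane"
    proof (rule image_subsetI)
      fix y assume y: "y \<in> slit_plane"
      have "Im (of_real r * y) = r * Im y" "Re (of_real r * y) = r * Re y" for r
        by simp_all
      from this[of "2 ^ Suc k"] have "Im (2 ^ Suc k * y) = 2 ^ Suc k * Im y" "Re (2 ^ Suc k * y) = 2 ^ Suc k * Re y"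
        unfolding of_real_power of_real_numeral .
      moreover have "(0::real) < 2 ^ Suc k" by (rule zero_less_power) simp
      ultimately show "2 ^ Suc k * y \<in> slit_plane"
        using y by (simp add: mult_le_0_iff not_less[symmetric] del: power_Suc)
    qed
  qed (intro holomorphic_intros)
  hence hol: "(\<lambda>y. lerch (- root_of_minus_one (Suc k)) (2 ^ Suc k * y)) holomorphic_on slit_plane" for k
    by (simp add: o_def)
  have "(\<lambda>y. \<Sum>k. lerch (- root_of_minus_one (Suc k)) (2 ^ Suc k * y)) holomorphic_on slit_plane"
  proof (rule holomorphic_on_suminf[OF open_slit_plane hol])
    fix y0 assume "y0 \<in> slit_plane"
    then obtain c d where c: "c > 0" "d > 0" "cball y0 d \<subseteq> slit_plane" "\<And>y. y \<in> cball y0 d \<Longrightarrow> away c c y"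
      by (rule slit_plane_locally_away) blast
    have "\<forall>n. \<forall>y\<in>cball y0 d. norm (lerch (- root_of_minus_one (Suc n)) (2 ^ Suc n * y))
        \<le> (1 / c + 1 / c ^ 2) / c * (1 / 2) ^ Suc n"
      using lerch_dyadic_bound[OF c(4) c(1) c(1)] by blast
    thus "\<exists>d M. d > 0 \<and> cball y0 d \<subseteq> slit_plane \<and> summable M \<and>
        (\<forall>n. \<forall>y\<in>cball y0 d. norm (lerch (- root_of_minus_one (Suc n)) (2 ^ Suc n * y)) \<le> M n)"
      using c summable_half_powers by blast
  qed
  moreover have "lerch (- 1) holomorphic_on slit_plane" by (intro lerch_holomorphic) auto
  ultimately have "(\<lambda>y. - lerch (- 1) y + (\<Sum>k. lerch (- root_of_minus_one (Suc k)) (2 ^ Suc k * y)))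
      holomorphic_on slit_plane"
    by (intro holomorphic_intros)
  thus ?thesis unfolding dyadic_sum_def .
qed

text \<open>Duplication at \<open>2 ^ k * y\<close> turns the \<open>k\<close>-th summand into
  \<open>T k - T (Suc k)\<close>. The sum telescopes, and \<open>T 0\<close> is the term
  \<open>lerch (- 1) y\<close> that \<open>dyadic_sum\<close> subtracts, so only the limit of
  \<open>T\<close> remains.\<close>

lemma lerch_dyadic_tendsto:
  assumes y: "away c R y" "c > 0" "R > 0"
  shows "(\<lambda>K. lerch (root_of_minus_one K) (2 ^ K * y)) \<longlonglongrightarrow> - dyadic_sum y"
proof -
  define T where "T = (\<lambda>K. lerch (root_of_minus_one K) (2 ^ K * y))"
  have step: "lerch (- root_of_minus_one (Suc k)) (2 ^ Suc k * y) = T k - T (Suc k)" for k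
  proof -
    have "lerch (- root_of_minus_one (Suc k)) (2 * (2 ^ k * y)) + lerch (root_of_minus_one (Suc k)) (2 * (2 ^ k * y))
        = lerch (root_of_minus_one k) (2 ^ k * y)"
      unfolding root_of_minus_one_Suc_square[of k, symmetric]
      using y by (intro lerch_duplication[OF _ _ _ away_two_power] norm_root_of_minus_one
          root_of_minus_one_neq_1 root_of_minus_one_Suc_neq_minus_1) auto
    thus ?thesis by (simp add: T_def mult.assoc eq_diff_eq)
  qed
  have "(\<Sum>k<K. T k - T (Suc k)) = T 0 - T K" for K by (rule sum_lessThan_telescope')
  moreover have "(\<lambda>K. \<Sum>k<K. T k - T (Suc k)) \<longlonglongrightarrow> (\<Sum>k. T k - T (Suc k))"
    using summable_lerch_dyadic[OF y] unfolding step by (rule summable_LIMSEQ)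
  ultimately have "(\<lambda>K. T 0 - T K) \<longlonglongrightarrow> (\<Sum>k. T k - T (Suc k))" by simp
  hence "(\<lambda>K. T 0 - (T 0 - T K)) \<longlonglongrightarrow> T 0 - (\<Sum>k. T k - T (Suc k))"
    by (intro tendsto_intros)
  moreover have "- dyadic_sum y = T 0 - (\<Sum>k. T k - T (Suc k))"
    unfolding dyadic_sum_def step by (simp add: T_def)
  ultimately show ?thesis by (simp add: T_def)
qed

section \<open>Laplace representation\<close>

lemma integrable_exp_decay:
  assumes "a > 0"
  shows "(\<lambda>t::real. C * exp (- (a * t))) integrable_on {0..}"
    and "integral {0..} (\<lambda>t::real. C * exp (- (a * t))) = C / a"
proof -
  have "((\<lambda>t::real. C * exp (- a * t)) has_integral C * (exp (- a * 0) / a)) {0..}"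
    by (intro has_integral_mult_right has_integral_exp_minus_to_infinity assms)
  hence *: "((\<lambda>t::real. C * exp (- (a * t))) has_integral C / a) {0..}" by simp
  show "(\<lambda>t::real. C * exp (- (a * t))) integrable_on {0..}"
    and "integral {0..} (\<lambda>t::real. C * exp (- (a * t))) = C / a"
    by (rule has_integral_integrable[OF *], rule integral_unique[OF *])
qed

text \<open>Dominated convergence for truncations to \<open>{0..real n}\<close>. The limit statement
  lets improper integrals be evaluated through primitives on compact intervals.\<close>

lemma integral_exp_dominated:
  fixes f :: "real \<Rightarrow> complex"
  assumes cont: "continuous_on {0..} f" and a: "a > 0"
    and bd: "\<And>t. t \<ge> 0 \<Longrightarrow> norm (f t) \<le> C * exp (- (a * t))"
  shows "f integrable_on {0..}"
    and "(\<lambda>n. integral {0..real n} f) \<longlonglongrightarrow> integral {0..} f"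
    and "norm (integral {0..} f) \<le> C / a"
proof -
  define g where "g = (\<lambda>(n::nat) t. if t \<in> {..real n} then f t else 0)"
  have Int: "{..real n} \<inter> {0..} = {0..real n}" for n by auto
  have g: "g n integrable_on {0..}" for n
    unfolding g_def integrable_restrict_Int Int
    by (intro integrable_continuous_interval continuous_on_subset[OF cont]) auto
  have gb: "norm (g n t) \<le> C * exp (- (a * t))" if "t \<in> {0..}" for n t
    using bd[of t] norm_ge_zero[of "f t"] that by (auto simp: g_def simp del: norm_ge_zero)
  have lim: "(\<lambda>n. g n t) \<longlonglongrightarrow> f t" if "t \<in> {0..}" for t
  proof (rule tendsto_eventually)
    obtain N :: nat where N: "t \<le> real N" using real_arch_simple by blast
    show "\<forall>\<^sub>F n in sequentially. g n t = f t"
      using eventually_ge_at_top[of N] by eventually_elim (use N in \<open>simp add: g_def\<close>)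
  qed
  show int: "f integrable_on {0..}"
    by (rule dominated_convergence(1)[OF g integrable_exp_decay(1)[OF a] gb lim])
  have "(\<lambda>n. integral {0..} (g n)) \<longlonglongrightarrow> integral {0..} f"
    by (rule dominated_convergence(2)[OF g integrable_exp_decay(1)[OF a] gb lim])
  thus "(\<lambda>n. integral {0..real n} f) \<longlonglongrightarrow> integral {0..} f"
    unfolding g_def Henstock_Kurzweil_Integration.integral_restrict_Int Int .
  show "norm (integral {0..} f) \<le> C / a"
    unfolding integrable_exp_decay(2)[OF a, of C, symmetric]
    by (intro Henstock_Kurzweil_Integration.integral_norm_bound_integral int
        integrable_exp_decay a) (use bd in auto)
qed

lemma laplace_transform_one:
  assumes "Re Y > 0"
  shows "((\<lambda>u. exp (- (Y * of_real u))) has_integral 1 / Y) {0..}"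
proof -
  have Y0: "Y \<noteq> 0" using assms by auto
  define f where "f = (\<lambda>u::real. exp (- (Y * of_real u)))"
  have bd: "norm (f t) \<le> 1 * exp (- (Re Y * t))" for t
    by (simp add: f_def)
  have cont: "continuous_on {0..} f" unfolding f_def by (intro continuous_intros)
  note * = integral_exp_dominated[OF cont assms bd]
  have "(f has_integral (- exp (- (Y * of_real (real n))) / Y - (- exp (- (Y * of_real 0)) / Y))) {0..real n}" for n
    unfolding f_def
  proof (rule fundamental_theorem_of_calculus)
    fix u :: real
    show "((\<lambda>u. - exp (- (Y * of_real u)) / Y) has_vector_derivative exp (- (Y * of_real u))) (at u within {0..real n})"
      by (rule has_vector_derivative_real_field) (use Y0 in \<open>auto intro!: derivative_eq_intros\<close>)
  qed simp
  hence int: "integral {0..real n} f = 1 / Y - exp (- (Y * of_real (real n))) / Y" for n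
    by (simp add: integral_unique)
  have "(\<lambda>n. exp (- (Y * of_real (real n)))) \<longlonglongrightarrow> 0"
  proof (rule tendsto_norm_zero_cancel)
    have "(\<lambda>n. exp (- (Re Y * real n))) \<longlonglongrightarrow> 0" using assms by real_asymp
    thus "(\<lambda>n. norm (exp (- (Y * of_real (real n))))) \<longlonglongrightarrow> 0" by simp
  qed
  hence "(\<lambda>n. 1 / Y - exp (- (Y * of_real (real n))) / Y) \<longlonglongrightarrow> 1 / Y - 0 / Y"
    using Y0 by (intro tendsto_intros)
  with *(2) have "integral {0..} f = 1 / Y" unfolding int by (simp add: LIMSEQ_unique)
  thus ?thesis using *(1) by (simp add: f_def has_integral_integral)
qed

text \<open>Halving the angle at most halves the sine in this range, starting from
  \<open>sin (pi / 2) = 1\<close>.\<close>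

lemma sin_dyadic_ge: "1 / 2 ^ k \<le> sin (pi / 2 ^ Suc k)"
proof (induction k)
  case (Suc k)
  have "sin (2 * (pi / 2 ^ Suc (Suc k))) = 2 * sin (pi / 2 ^ Suc (Suc k)) * cos (pi / 2 ^ Suc (Suc k))"
    by (rule sin_double)
  also have "\<dots> \<le> 2 * sin (pi / 2 ^ Suc (Suc k)) * 1"
  proof (intro mult_left_mono mult_nonneg_nonneg sin_ge_zero)
    have "pi / 2 ^ Suc (Suc k) \<le> pi / 1"
      by (intro divide_left_mono one_le_power) auto
    thus "pi / 2 ^ Suc (Suc k) \<le> pi" by simp
  qed auto
  finally show ?case using Suc by simp
qed simp

text \<open>
  For small \<open>h u\<close> only the argument keeps \<open>exp (h (i \<pi> - u))\<close> away from 1, for large \<open>h u\<close> only its modulus does.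
\<close>

lemma one_minus_dyadic_exp_bound:
  fixes u :: real and k :: nat
  assumes "u \<ge> 0"
  defines "h \<equiv> 1 / 2 ^ Suc k"
  shows "norm (1 - root_of_minus_one (Suc k) * of_real (exp (- (h * u)))) \<ge> h / 2"
proof -
  define r where "r = root_of_minus_one (Suc k) * of_real (exp (- (h * u)))"
  have h: "0 < h" "h \<le> 1 / 2"
  proof -
    show "0 < h" by (simp add: h_def)
    have "1 / 2 ^ Suc k \<le> (1::real) / 2 ^ 1" by (intro divide_left_mono power_increasing) auto
    thus "h \<le> 1 / 2" by (simp add: h_def)
  qed
  have e: "exp (1::real) \<le> 4" using exp_le by linarith
  show ?thesis
  proof (cases "h * u \<le> 1")
    case True
    have "Im r = sin (pi / 2 ^ Suc k) * exp (- (h * u))"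
      by (simp add: r_def root_of_minus_one_def)
    \<comment> \<open>The sine is at least \<open>2 * h\<close> by \<open>sin_dyadic_ge\<close>, and
      \<open>exp (- 1) \<ge> 1 / 4\<close> because e is at most 4.\<close>
    also have "\<dots> \<ge> (2 * h) * (1 / 4)"
    proof (rule mult_mono)
      show "2 * h \<le> sin (pi / 2 ^ Suc k)" using sin_dyadic_ge[of k] by (simp add: h_def)
      thus "0 \<le> sin (pi / 2 ^ Suc k)" using h by linarith
      have "1 / 4 \<le> exp (- (1::real))" using e by (simp add: exp_minus field_simps)
      also have "\<dots> \<le> exp (- (h * u))" using True by simp
      finally show "1 / 4 \<le> exp (- (h * u))" .
    qed auto
    finally have "h / 2 \<le> \<bar>Im (1 - r)\<bar>" by simp
    also have "\<dots> \<le> norm (1 - r)" by (rule abs_Im_le_cmod)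
    finally show ?thesis by (simp add: r_def)
  next
    case False
    have "norm r = exp (- (h * u))" by (simp add: r_def norm_mult)
    also have "\<dots> \<le> exp (- 1)" using False by simp
    also have "\<dots> \<le> 1 / 2"
      using exp_ge_add_one_self[of 1] by (simp add: exp_minus field_simps)
    finally have "1 - norm r \<ge> h / 2" using h by linarith
    also have "1 - norm r \<le> norm (1 - r)" using norm_triangle_ineq2[of 1 r] by simp
    finally show ?thesis by (simp add: r_def)
  qed
qed

text \<open>Each summand is \<open>h * q ^ j\<close> times the Laplace integral of 1 at
  \<open>y + j * h\<close>, and the geometric series is summed under the integral. Working in the
  variable scaled by \<open>h\<close> keeps \<open>exp (- (y * u))\<close> free of \<open>k\<close>,
  and the \<open>h\<close> in the numerator cancels the bound \<open>h / 2\<close> on the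
  denominator, so the majorant is uniform in \<open>k\<close>.\<close>

lemma lerch_dyadic_laplace:
  fixes y :: complex and k :: nat
  assumes y: "Re y > 0"
  defines "h \<equiv> 1 / 2 ^ Suc k"
  defines "f \<equiv> \<lambda>u::real. exp (- (y * of_real u)) * of_real h / (1 - root_of_minus_one (Suc k) * of_real (exp (- (h * u))))"
  shows "(\<lambda>j. root_of_minus_one (Suc k) ^ j / (2 ^ Suc k * y + of_nat j)) sums integral {0..} f"
    and "continuous_on {0..} f" and "\<And>u. u \<ge> 0 \<Longrightarrow> norm (f u) \<le> 2 * exp (- (Re y * u))"
proof -
  define q where "q = root_of_minus_one (Suc k)"
  define r where "r = (\<lambda>u::real. q * of_real (exp (- (h * u))))"
  have h: "h > 0" by (simp add: h_def)
  have q: "norm q = 1" by (simp add: q_def)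
  have den: "norm (1 - r u) \<ge> h / 2" if "u \<ge> 0" for u
    unfolding r_def q_def h_def by (rule one_minus_dyadic_exp_bound[OF that])
  have ne: "1 - r u \<noteq> 0" if "u \<ge> 0" for u
    using den[OF that] h by auto
  have f: "f u = exp (- (y * of_real u)) * of_real h / (1 - r u)" for u
    by (simp add: f_def r_def q_def)
  have contr: "continuous_on {0..} r" unfolding r_def by (intro continuous_intros)
  show cont: "continuous_on {0..} f"
    unfolding f by (intro continuous_intros contr) (use ne in auto)
  show bd: "norm (f u) \<le> 2 * exp (- (Re y * u))" if "u \<ge> 0" for u
  proof -
    have "norm (f u) = exp (- (Re y * u)) * h / norm (1 - r u)"
      using h by (simp add: f norm_mult norm_divide)
    also have "\<dots> \<le> exp (- (Re y * u)) * h / (h / 2)"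
      using h den[OF that] by (intro divide_left_mono mult_pos_pos) (auto intro: less_le_trans[OF _ den[OF that]])
    finally show ?thesis using h by simp
  qed
  have intf: "f integrable_on {0..}" by (rule integral_exp_dominated(1)[OF cont y bd])
  \<comment> \<open>\<open>g N\<close> is the remainder of the finite geometric sum. Keeping it
    explicit avoids interchanging an infinite sum with the integral; its integral is at most
    \<open>2 / (Re y + real N * h)\<close> in norm.\<close>
  define g where "g = (\<lambda>N u. f u * r u ^ N)"
  have contg: "continuous_on {0..} (g N)" for N
    unfolding g_def by (intro continuous_intros cont contr)
  have bdg: "norm (g N u) \<le> 2 * exp (- ((Re y + real N * h) * u))" if "u \<ge> 0" for N u
  proof -
    have "norm (r u ^ N) = exp (- (real N * h * u))"
      using q by (simp add: r_def norm_mult norm_power exp_of_nat_mult[symmetric] mult.assoc)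
    moreover have "norm (f u) * norm (r u ^ N) \<le> 2 * exp (- (Re y * u)) * norm (r u ^ N)"
      using bd[OF that] by (intro mult_right_mono) auto
    moreover have "exp (- (Re y * u)) * exp (- (real N * h * u)) = exp (- ((Re y + real N * h) * u))"
      by (simp add: mult_exp_exp distrib_right)
    ultimately show ?thesis
      by (simp only: g_def norm_mult mult.assoc)
  qed
  have pos: "Re y + real N * h > 0" for N using y h by (simp add: add_pos_nonneg)
  note G = integral_exp_dominated[OF contg pos bdg]
  have summand: "((\<lambda>u. exp (- (y * of_real u)) * of_real h * r u ^ j) has_integral q ^ j / (2 ^ Suc k * y + of_nat j)) {0..}" for j
  proof -
    have "Re (y + of_nat j * of_real h) > 0" using pos[of j] by simp
    from has_integral_mult_right[OF laplace_transform_one[OF this], of "of_real h * q ^ j"]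
    have "((\<lambda>u. of_real h * q ^ j * exp (- ((y + of_nat j * of_real h) * of_real u))) has_integral
        of_real h * q ^ j * (1 / (y + of_nat j * of_real h))) {0..}" .
    also have "(\<lambda>u. of_real h * q ^ j * exp (- ((y + of_nat j * of_real h) * of_real u))) =
        (\<lambda>u. exp (- (y * of_real u)) * of_real h * r u ^ j)"
      by (simp add: r_def fun_eq_iff power_mult_distrib exp_of_nat_mult[symmetric] distrib_right
          exp_add[symmetric] exp_of_real[symmetric] mult_exp_exp exp_diff exp_minus field_simps)
    also have "of_real h * q ^ j * (1 / (y + of_nat j * of_real h)) = q ^ j / (2 ^ Suc k * y + of_nat j)"
      by (simp add: h_def field_simps)
    finally show ?thesis .
  qed
  have partial: "(\<Sum>j<N. q ^ j / (2 ^ Suc k * y + of_nat j)) = integral {0..} f - integral {0..} (g N)" for N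
  proof -
    have "((\<lambda>u. \<Sum>j<N. exp (- (y * of_real u)) * of_real h * r u ^ j) has_integral
        (\<Sum>j<N. q ^ j / (2 ^ Suc k * y + of_nat j))) {0..}"
      by (intro has_integral_sum summand) auto
    moreover have "((\<lambda>u. f u - g N u) has_integral (integral {0..} f - integral {0..} (g N))) {0..}"
      by (intro has_integral_diff integrable_integral intf G(1))
    moreover have "(\<Sum>j<N. exp (- (y * of_real u)) * of_real h * r u ^ j) = f u - g N u" if "u \<in> {0..}" for u
    proof -
      have "r u \<noteq> 1" using ne[of u] that by auto
      hence gp: "(\<Sum>j<N. r u ^ j) = (1 - r u ^ N) / (1 - r u)" by (simp add: sum_gp_strict)
      show ?thesis
        unfolding sum_distrib_left[symmetric] gp
        by (simp add: f g_def diff_divide_distrib right_diff_distrib)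
    qed
    ultimately show ?thesis
      by (metis (no_types, lifting) has_integral_cong has_integral_unique)
  qed
  have "(\<lambda>N. integral {0..} (g N)) \<longlonglongrightarrow> 0"
  proof (rule Lim_null_comparison)
    show "\<forall>\<^sub>F N in sequentially. norm (integral {0..} (g N)) \<le> 2 / (Re y + real N * h)"
      using G(3) by simp
    show "(\<lambda>N. 2 / (Re y + real N * h)) \<longlonglongrightarrow> 0" using h by real_asymp
  qed
  hence "(\<lambda>N. integral {0..} f - integral {0..} (g N)) \<longlonglongrightarrow> integral {0..} f - 0"
    by (intro tendsto_intros)
  thus "(\<lambda>j. root_of_minus_one (Suc k) ^ j / (2 ^ Suc k * y + of_nat j)) sums integral {0..} f"
    unfolding sums_def q_def[symmetric] partial by simp
qed

text \<open>With \<open>v = \<i> * pi - u\<close> the denominator in \<open>f k\<close> is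
  \<open>1 - exp (h k * v)\<close>, and \<open>h / (1 - exp (h * v))\<close> tends to
  \<open>- 1 / v\<close> as \<open>h\<close> tends to 0. Dominated convergence passes this limit
  under the integral.\<close>

lemma dyadic_sum_eq_laplace:
  assumes y: "Re y > 0"
  shows "dyadic_sum y = integral {0..} (\<lambda>u::real. exp (- (y * of_real u)) / (\<i> * of_real pi - of_real u))"
proof -
  define h :: "nat \<Rightarrow> real" where "h = (\<lambda>k. 1 / 2 ^ Suc k)"
  define f where "f = (\<lambda>k u. exp (- (y * of_real u)) * of_real (h k) /
      (1 - root_of_minus_one (Suc k) * of_real (exp (- (h k * u)))))"
  note L = lerch_dyadic_laplace[OF y, folded h_def f_def]
  have "y \<in> slit_plane" using y by auto
  then obtain c d where c: "c > 0" "d > 0" "cball y d \<subseteq> slit_plane" "\<And>z. z \<in> cball y d \<Longrightarrow> away c c z"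
    by (rule slit_plane_locally_away) blast
  hence "away c c y" by simp
  \<comment> \<open>The Laplace representation covers positive indices only, so the sequence is
    shifted by one, which keeps its limit.\<close>
  from LIMSEQ_Suc[OF lerch_dyadic_tendsto[OF this c(1) c(1)]]
  have "(\<lambda>k. integral {0..} (f k)) \<longlonglongrightarrow> - dyadic_sum y"
    using L(1) by (simp add: lerch_def sums_iff h_def f_def)
  moreover have "(\<lambda>k. integral {0..} (f k)) \<longlonglongrightarrow>
      integral {0..} (\<lambda>u. - (exp (- (y * of_real u)) / (\<i> * of_real pi - of_real u)))"
  proof (rule dominated_convergence(2))
    show "f k integrable_on {0..}" for k
      using L by (intro integral_exp_dominated(1)[OF _ y]) (auto simp: h_def f_def)
    show "(\<lambda>u. 2 * exp (- (Re y * u))) integrable_on {0..}" by (rule integrable_exp_decay[OF y])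
    show "norm (f k u) \<le> 2 * exp (- (Re y * u))" if "u \<in> {0..}" for k u
      using L(3)[of u k] that by (simp add: h_def f_def)
    fix u :: real assume "u \<in> {0..}"
    define v where "v = \<i> * of_real pi - of_real u"
    have v: "v \<noteq> 0" by (auto simp: v_def complex_eq_iff)
    have "h \<longlonglongrightarrow> 0" unfolding h_def by real_asymp
    hence "(\<lambda>k. of_real (h k) * v) \<longlonglongrightarrow> of_real 0 * v" by (intro tendsto_intros)
    hence "filterlim (\<lambda>k. of_real (h k) * v) (at 0) sequentially"
      using v by (intro filterlim_atI) (auto simp: h_def)
    moreover have "((\<lambda>z::complex. (exp z - 1) / z) \<longlongrightarrow> 1) (at 0)"
      using DERIV_D[OF DERIV_exp[of "0::complex"]] by simp
    ultimately have "(\<lambda>k. (exp (of_real (h k) * v) - 1) / (of_real (h k) * v)) \<longlonglongrightarrow> 1"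
      by (rule filterlim_compose[rotated])
    hence "(\<lambda>k. - (exp (- (y * of_real u)) / v) / ((exp (of_real (h k) * v) - 1) / (of_real (h k) * v))) \<longlonglongrightarrow>
        - (exp (- (y * of_real u)) / v) / 1"
      by (intro tendsto_intros) auto
    moreover have "- (exp (- (y * of_real u)) / v) / ((exp (of_real (h k) * v) - 1) / (of_real (h k) * v)) = f k u" for k
    proof -
      have "exp (of_real (h k) * v) = root_of_minus_one (Suc k) * of_real (exp (- (h k * u)))"
        by (simp add: v_def h_def root_of_minus_one_def cis_conv_exp exp_of_real[symmetric]
            mult_exp_exp diff_divide_distrib mult_ac)
      moreover have "h k \<noteq> 0" by (simp add: h_def)
      ultimately show ?thesis using v
        by (simp add: f_def divide_simps) (simp add: algebra_simps)
    qed
    ultimately show "(\<lambda>k. f k u) \<longlonglongrightarrow> - (exp (- (y * of_real u)) / (\<i> * of_real pi - of_real u))"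
      by (simp add: v_def)
  qed
  ultimately have "- dyadic_sum y = integral {0..} (\<lambda>u. - (exp (- (y * of_real u)) / (\<i> * of_real pi - of_real u)))"
    by (rule LIMSEQ_unique)
  thus ?thesis by simp
qed

section \<open>Rotation of the integration path\<close>

text \<open>The centre \<open>1 - \<i>\<close> lies below the slit on its own line. A segment from
  it to a point off that line meets the line only at the centre, and one to a point below the slit
  stays below. Starlikeness provides a global primitive.\<close>

lemma starlike_vertical_slit: "starlike {p. \<not> (Re p = 1 \<and> Im p \<ge> 0)}"
  unfolding starlike_def
proof (intro bexI ballI subsetI)
  fix p z assume p: "p \<in> {p. \<not> (Re p = 1 \<and> Im p \<ge> 0)}" and "z \<in> closed_segment (1 - \<i>) p"
  then obtain t where t: "0 \<le> t" "t \<le> 1" and z: "z = (1 - t) *\<^sub>R (1 - \<i>) + t *\<^sub>R p"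
    by (auto simp: in_segment)
  have Re: "Re z = 1 + t * (Re p - 1)" and Im: "Im z = - (1 - t) + t * Im p"
    by (simp_all add: z algebra_simps)
  show "z \<in> {p. \<not> (Re p = 1 \<and> Im p \<ge> 0)}"
  proof (cases "Re z = 1")
    case True
    have "Im z < 0"
    proof (cases "t = 0")
      case False
      hence "Im p < 0" using True p by (auto simp: Re)
      hence "t * Im p < 0" using False t by (simp add: mult_less_0_iff)
      thus ?thesis using t by (simp add: Im)
    qed (simp add: Im)
    thus ?thesis by simp
  qed simp
qed simp

lemma open_vertical_slit: "open {p. \<not> (Re p = 1 \<and> Im p \<ge> 0)}"
proof -
  have "closed {p. Re p = 1 \<and> Im p \<ge> 0}"
    by (intro closed_Collect_conj closed_Collect_eq closed_Collect_le continuous_intros)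
  moreover have "{p. \<not> (Re p = 1 \<and> Im p \<ge> 0)} = - {p. Re p = 1 \<and> Im p \<ge> 0}" by auto
  ultimately show ?thesis by (metis open_Compl)
qed

text \<open>
  The integrand has a primitive \<open>\<phi>\<close> on the plane slit along \<open>1 + i[0, \<infinity>)\<close>, so the path may be rotated
  to the negative imaginary axis as soon as \<open>\<phi> (n - i) - \<phi> (-i n / \<pi>) \<longlonglongrightarrow> 0\<close>.
\<close>

lemma exp_Ei_plus_integral_eq_laplace:
  assumes x: "Re x > 0" "Im x > 0" and y: "y = - \<i> * x / of_real pi"
  shows "exp_Ei_plus_integral x = integral {0..} (\<lambda>u::real. exp (- (y * of_real u)) / (\<i> * of_real pi - of_real u))"
proof -
  define D where "D = {p. \<not> (Re p = 1 \<and> Im p \<ge> 0)}"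
  define f where "f = (\<lambda>p. exp (- p * x) / (1 - p))"
  have D1: "1 - p \<noteq> 0" if "p \<in> D" for p using that by (auto simp: D_def)
  have open_D: "open D" and star_D: "starlike D"
    unfolding D_def by (rule open_vertical_slit starlike_vertical_slit)+
  have hol: "f holomorphic_on D" unfolding f_def
    by (intro holomorphic_intros D1)
  have contf: "continuous_on D f" by (rule holomorphic_on_imp_continuous_on[OF hol])
  have "\<exists>\<phi>. \<forall>p\<in>D. (\<phi> has_field_derivative f p) (at p)"
    using holomorphic_on_imp_differentiable_at[OF hol open_D]
    by (intro holomorphic_starlike_primitive[OF contf star_D open_D finite.emptyI]) simp
  then obtain \<phi> where \<phi>: "\<And>p. p \<in> D \<Longrightarrow> (\<phi> has_field_derivative f p) (at p)"
    by (elim exE) (rule that, erule bspec)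
  have path: "(f has_contour_integral (\<phi> b - \<phi> a)) (linepath a b)" if "closed_segment a b \<subseteq> D" for a b
    using contour_integral_primitive[of D \<phi> f "linepath a b"] that \<phi>
    by (auto intro: has_field_derivative_at_within)
  have norm_exp: "norm (exp (- p * x)) = exp (- (Re p * Re x - Im p * Im x))" for p
    by simp
  have seg: "contour_integral (linepath 0 (- \<i>)) f = \<phi> (- \<i>) - \<phi> 0"
    by (intro contour_integral_unique path) (auto simp: D_def in_segment)
  \<comment> \<open>Stated for a general ray, since it serves both the horizontal half-line from
    \<open>- \<i>\<close> and the negative imaginary axis from 0.\<close>
  have ftc: "integral {0..real n} (\<lambda>t. f (a + c * of_real t) * c) = \<phi> (a + c * of_real (real n)) - \<phi> a"
    if "\<And>t. t \<ge> 0 \<Longrightarrow> a + c * of_real t \<in> D" for a c n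
  proof -
    have "((\<lambda>t. f (a + c * of_real t) * c) has_integral
        (\<phi> (a + c * of_real (real n)) - \<phi> (a + c * of_real 0))) {0..real n}"
    proof (rule fundamental_theorem_of_calculus)
      fix t assume "t \<in> {0..real n}"
      hence "a + c * of_real t \<in> D" using that by simp
      hence "((\<lambda>z. \<phi> (a + c * z)) has_field_derivative f (a + c * of_real t) * c) (at (of_real t))"
        by (intro DERIV_chain2[OF \<phi>]) (auto intro!: derivative_eq_intros)
      thus "((\<lambda>t. \<phi> (a + c * of_real t)) has_vector_derivative f (a + c * of_real t) * c) (at t within {0..real n})"
        by (rule has_vector_derivative_real_field)
    qed simp
    from integral_unique[OF this] show ?thesis
      by (simp only: of_real_0 mult_zero_right add_0_right)
  qed
  have cont: "continuous_on {0..} (\<lambda>t. f (a + c * of_real t) * c)"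
    if "\<And>t::real. t \<ge> 0 \<Longrightarrow> a + c * of_real t \<in> D" for a c
    by (intro continuous_intros continuous_on_compose2[OF contf]) (use that in auto)

  define f1 where "f1 = (\<lambda>t::real. f (- \<i> + 1 * of_real t) * 1)"
  have f1: "continuous_on {0..} f1" unfolding f1_def
    by (rule cont) (auto simp: D_def)
  have bd1: "norm (f1 t) \<le> 1 * exp (- (Re x * t))" if "t \<ge> 0" for t
  proof -
    have "norm (f1 t) = exp (- (t * Re x + Im x)) / norm (1 - (- \<i> + of_real t))"
      unfolding f1_def f_def norm_divide norm_mult norm_exp by simp
    also have "\<dots> \<le> exp (- (t * Re x + Im x)) / 1"
      using abs_Im_le_cmod[of "1 - (- \<i> + of_real t)"] by (intro divide_left_mono) auto
    also have "\<dots> \<le> exp (- (t * Re x))" using x by simp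
    finally show ?thesis by (simp add: mult.commute)
  qed
  have int1: "integral {0..real n} f1 = \<phi> (- \<i> + of_nat n) - \<phi> (- \<i>)" for n
    unfolding f1_def by (subst ftc) (simp_all add: D_def)
  have lim1: "(\<lambda>n. \<phi> (- \<i> + of_nat n) - \<phi> (- \<i>)) \<longlonglongrightarrow> integral {0..} f1"
    using integral_exp_dominated(2)[OF f1 x(1) bd1] unfolding int1 .

  \<comment> \<open>The substitution \<open>p = - \<i> * u / pi\<close> on the rotated path turns
    \<open>p * x\<close> into \<open>y * u\<close> and produces the denominator
    \<open>\<i> * pi - u\<close>.\<close>
  define f2 where "f2 = (\<lambda>u::real. f (0 + (- \<i> / of_real pi) * of_real u) * (- \<i> / of_real pi))"
  have f2_eq: "f2 u = exp (- (y * of_real u)) / (\<i> * of_real pi - of_real u)" for u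
  proof -
    have frac: "- \<i> / of_real pi / (1 - - \<i> / of_real pi * of_real u) = 1 / (\<i> * of_real pi - of_real u)"
    proof -
      have *: "1 - - \<i> / of_real pi * of_real u = (\<i> * of_real pi - of_real u) * (- \<i> / of_real pi)"
        by (simp add: field_simps)
      show ?thesis unfolding * by (rule nonzero_divide_mult_cancel_right) simp
    qed
    have arg: "exp (- (0 + - \<i> / of_real pi * of_real u) * x) = exp (- (y * of_real u))"
      by (simp add: y mult_ac)
    have f2: "f2 u = exp (- (0 + - \<i> / of_real pi * of_real u) * x) *
        (- \<i> / of_real pi / (1 - - \<i> / of_real pi * of_real u))"
    proof -
      have "E / A * B = E * (B / A)" for E A B :: complex by simp
      thus ?thesis unfolding f2_def f_def add_0_left .
    qed
    show ?thesis unfolding f2 frac arg by simp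
  qed
  have f2: "continuous_on {0..} f2" unfolding f2_def
    by (rule cont) (auto simp: D_def)
  have bd2: "norm (f2 u) \<le> 1 * exp (- (Re y * u))" for u
  proof -
    have "1 \<le> norm (\<i> * of_real pi - of_real u)"
      using abs_Im_le_cmod[of "\<i> * of_real pi - of_real u"] pi_gt3 by simp
    hence "exp (- (Re y * u)) / norm (\<i> * of_real pi - of_real u) \<le> exp (- (Re y * u)) / 1"
      by (intro divide_left_mono) auto
    thus ?thesis by (simp add: f2_eq norm_divide)
  qed
  have Re_y: "Re y > 0" using x by (simp add: y)
  have int2: "integral {0..real n} f2 = \<phi> (- \<i> / of_real pi * of_nat n) - \<phi> 0" for n
    unfolding f2_def by (subst ftc) (simp_all add: D_def)
  have lim2: "(\<lambda>n. \<phi> (- \<i> / of_real pi * of_nat n) - \<phi> 0) \<longlonglongrightarrow> integral {0..} f2"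
    using integral_exp_dominated(2)[OF f2 Re_y bd2] unfolding int2 .

  \<comment> \<open>On the segment joining the two truncated paths, the decay exponent interpolates
    between \<open>n * Re x + Im x\<close> and \<open>n * Im x / pi\<close>; both are at least
    \<open>m * n\<close>. The factor \<open>2 * n + 1\<close> below bounds the segment's
    length.\<close>
  define m where "m = min (Re x) (Im x / pi)"
  have m: "m > 0" "m \<le> Re x" "m \<le> Im x / pi" using x by (auto simp: m_def)
  have "(\<lambda>n. \<phi> (- \<i> / of_real pi * of_nat n) - \<phi> (- \<i> + of_nat n)) \<longlonglongrightarrow> 0"
  proof (rule Lim_null_comparison)
    show "(\<lambda>n. exp (- (m * real n)) * (2 * real n + 1)) \<longlonglongrightarrow> 0" using m(1) by real_asymp
    show "\<forall>\<^sub>F n in sequentially. norm (\<phi> (- \<i> / of_real pi * of_nat n) - \<phi> (- \<i> + of_nat n))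
        \<le> exp (- (m * real n)) * (2 * real n + 1)"
      \<comment> \<open>From \<open>n \<ge> 4\<close> on, \<open>n / pi \<ge> 1\<close>, so the
        segment stays in \<open>Im p \<le> - 1\<close>. There it avoids the slit and
        \<open>norm (1 - p) \<ge> 1\<close>.\<close>
      using eventually_ge_at_top[of 4]
    proof eventually_elim
      case (elim n)
      have n: "real n / pi \<ge> 1" using elim pi_less_4 by (simp add: field_simps)
      define a where "a = - \<i> + of_nat n"
      define b where "b = - \<i> / of_real pi * of_nat n"
      have pts: "Im p \<le> - 1 \<and> Re p * Re x - Im p * Im x \<ge> m * real n" if "p \<in> closed_segment a b" for p
      proof -
        from that obtain t where t: "0 \<le> t" "t \<le> 1" and p: "p = (1 - t) *\<^sub>R a + t *\<^sub>R b"
          by (auto simp: in_segment)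
        have Re: "Re p = (1 - t) * real n" and Im: "Im p = - ((1 - t) + t * (real n / pi))"
          by (simp_all add: p a_def b_def)
        have "t * 1 \<le> t * (real n / pi)" using t n by (intro mult_left_mono)
        hence "Im p \<le> - 1" by (simp add: Im)
        moreover have "m * real n \<le> Re p * Re x - Im p * Im x"
        proof -
          have "m * real n = (1 - t) * real n * m + t * real n * m" by (simp add: algebra_simps)
          also have "\<dots> \<le> (1 - t) * real n * Re x + t * real n * (Im x / pi)"
            using t m by (intro add_mono mult_left_mono) auto
          also have "\<dots> \<le> Re p * Re x - Im p * Im x"
            using mult_nonneg_nonneg[of "1 - t" "Im x"] t x by (simp add: Re Im algebra_simps)
          finally show ?thesis .
        qed
        ultimately show ?thesis ..
      qed
      have "norm (\<phi> b - \<phi> a) \<le> exp (- (m * real n)) * norm (b - a)"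
      proof (rule has_contour_integral_bound_linepath)
        show "(f has_contour_integral (\<phi> b - \<phi> a)) (linepath a b)"
        proof (intro path subsetI)
          show "p \<in> D" if "p \<in> closed_segment a b" for p
            using pts[OF that] by (auto simp: D_def)
        qed
        fix p assume p: "p \<in> closed_segment a b"
        have "1 \<le> norm (1 - p)" using pts[OF p] abs_Im_le_cmod[of "1 - p"] by simp
        hence "norm (f p) \<le> norm (exp (- p * x)) / 1"
          unfolding f_def norm_divide by (intro divide_left_mono) auto
        also have "\<dots> \<le> exp (- (m * real n))" using pts[OF p] unfolding norm_exp by simp
        finally show "norm (f p) \<le> exp (- (m * real n))" .
      qed simp
      also have "norm (b - a) \<le> norm b + norm a" by (rule norm_triangle_ineq4)
      also have "norm b = real n / pi" by (simp add: b_def norm_mult norm_divide)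
      also have "\<dots> \<le> real n / 1" using pi_gt3 by (intro divide_left_mono) auto
      also have "norm a \<le> 1 + real n"
        unfolding a_def by (rule order_trans[OF norm_triangle_ineq]) simp
      finally show ?case by (simp add: a_def b_def mult_left_mono)
    qed
  qed
  from tendsto_add[OF this lim1]
  have "(\<lambda>n. \<phi> (- \<i> / of_real pi * of_nat n) - \<phi> 0 - (\<phi> (- \<i>) - \<phi> 0)) \<longlonglongrightarrow> integral {0..} f1"
    by (simp add: algebra_simps)
  moreover have "(\<lambda>n. \<phi> (- \<i> / of_real pi * of_nat n) - \<phi> 0 - (\<phi> (- \<i>) - \<phi> 0)) \<longlonglongrightarrow>
      integral {0..} f2 - (\<phi> (- \<i>) - \<phi> 0)"
    by (intro tendsto_intros lim2)
  ultimately have "integral {0..} f1 = integral {0..} f2 - (\<phi> (- \<i>) - \<phi> 0)" by (rule LIMSEQ_unique)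
  moreover have "exp_Ei_plus_integral x = contour_integral (linepath 0 (- \<i>)) f + integral {0..} f1"
    by (simp only: exp_Ei_plus_integral_def f_def f1_def mult_1_left mult_1_right)
  ultimately have "exp_Ei_plus_integral x = integral {0..} f2" by (simp add: seg)
  thus ?thesis by (simp only: f2_eq[abs_def] f2_eq)
qed

section \<open>The dyadic expansion\<close>

lemma slit_plane_of_cut_plane:
  assumes "x \<in> cut_plane"
  shows "- \<i> * x / of_real pi \<in> slit_plane"
proof -
  have "Re (- \<i> * x / of_real pi) = Im x / pi" "Im (- \<i> * x / of_real pi) = - (Re x / pi)"
    by simp_all
  thus ?thesis using assms by (simp add: mem_cut_plane_iff pos_divide_le_eq)
qed

text \<open>The transformed \<open>dyadic_sum\<close> is itself a continuation. This proves that one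
  exists, so \<open>SOME\<close> in \<open>exp_Ei_plus\<close> picks a genuine continuation, and
  uniqueness identifies the two on the cut plane.\<close>

lemma exp_Ei_plus_eq_dyadic_sum:
  assumes "x \<in> cut_plane"
  shows "exp_Ei_plus x = dyadic_sum (- \<i> * x / of_real pi)"
proof -
  define F where "F = (\<lambda>x. dyadic_sum (- \<i> * x / of_real pi))"
  have "dyadic_sum \<circ> (\<lambda>x. - \<i> * x / of_real pi) holomorphic_on cut_plane"
    by (rule holomorphic_on_compose_gen[OF _ dyadic_sum_holomorphic])
       (use slit_plane_of_cut_plane in \<open>auto intro!: holomorphic_intros\<close>)
  moreover have "F x = exp_Ei_plus_integral x" if "Re x > 0" "Im x > 0" for x
  proof -
    have "Re (- \<i> * x / of_real pi) > 0" using that by simp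
    thus ?thesis
      unfolding F_def exp_Ei_plus_integral_eq_laplace[OF that refl] by (rule dyadic_sum_eq_laplace)
  qed
  ultimately have F: "is_exp_Ei_plus_continuation F"
    by (simp add: is_exp_Ei_plus_continuation_def F_def o_def)
  hence "is_exp_Ei_plus_continuation exp_Ei_plus"
    unfolding exp_Ei_plus_def by (rule someI[where P = is_exp_Ei_plus_continuation])
  from exp_Ei_plus_continuation_unique[OF this F assms] show ?thesis by (simp add: F_def)
qed

section \<open>Passage to the terms of the theorem\<close>

lemma bigo_Suc_imp_bigo:
  fixes f g :: "nat \<Rightarrow> real"
  assumes "(\<lambda>m. f (Suc m)) \<in> O(\<lambda>m. g (Suc m))"
  shows "f \<in> O(g)"
proof -
  from assms obtain c where "\<forall>\<^sub>F m in sequentially. norm (f (Suc m)) \<le> c * norm (g (Suc m))"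
    by (elim landau_o.bigE)
  hence "\<forall>\<^sub>F m in sequentially. norm (f m) \<le> c * norm (g m)"
    by (simp only: eventually_sequentially_Suc[of "\<lambda>m. norm (f m) \<le> c * norm (g m)"])
  thus ?thesis by (rule bigoI)
qed

text \<open>Kept general in \<open>e\<close> and \<open>Y\<close> so that both families of the
  theorem are instances: \<open>a\<close> with \<open>e = 1\<close> at \<open>y\<close>, and
  \<open>b k\<close> with \<open>e k\<close> at \<open>2 ^ k * y\<close>.\<close>

lemma inverse_factorial_series_eq_lerch:
  fixes e Y :: complex and t :: "nat \<Rightarrow> complex"
  assumes e: "norm e = 1" "norm (1 + e) > 1" and Y: "away c R Y" "c > 0" "R > 0"
    and t: "\<And>m. m \<ge> 1 \<Longrightarrow> t m = Gamma (of_nat m) * e / (1 + e) ^ m * (1 / pochhammer Y m)"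
  shows "summable (\<lambda>m. t (Suc m))" and "(\<Sum>m. t (Suc m)) = lerch (- 1 / e) Y"
    and "\<exists>\<rho>::real. 0 < \<rho> \<and> \<rho> < 1 \<and> (\<lambda>m. norm (t m)) \<in> O(\<lambda>m. \<rho> ^ m)"
proof -
  have Yn: "\<forall>n. Y \<noteq> - of_nat n"
    using away_nonzero[OF Y] by (metis add.left_inverse)
  define s where "s = (\<lambda>m. fact m / pochhammer Y (Suc m) / (1 + e) ^ Suc m)"
  have ts: "t (Suc m) = e * s m" for m
    using Gamma_fact[of m, where 'a = complex] t[of "Suc m"] by (simp add: s_def mult_ac)
  have s: "summable (\<lambda>m. norm (s m))"
    unfolding s_def by (rule inverse_factorial_series(1)[OF Yn e(2)])
  show "summable (\<lambda>m. t (Suc m))"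
    unfolding ts by (intro summable_mult summable_norm_cancel[OF s])
  have q: "norm (- 1 / e) = 1" "- 1 / e \<noteq> 1"
  proof -
    show "norm (- 1 / e) = 1" using e by (subst norm_divide) simp
    have "e \<noteq> - 1" using e by auto
    thus "- 1 / e \<noteq> 1" by (metis divide_eq_1_iff)
  qed
  have "(\<Sum>m. t (Suc m)) = (\<Sum>m. fact m * e / pochhammer Y (Suc m) / (1 + e) ^ Suc m)"
    unfolding ts s_def by (simp add: mult_ac)
  also have "\<dots> = lerch (- 1 / e) Y"
    by (rule sums_unique2[OF inverse_factorial_series_sums[OF Yn e] lerch_sums[OF q Y]])
  finally show "(\<Sum>m. t (Suc m)) = lerch (- 1 / e) Y" .
  have "\<exists>\<rho>::real. 0 < \<rho> \<and> \<rho> < 1 \<and> (\<lambda>m. norm (s m)) \<in> O(\<lambda>m. \<rho> ^ Suc m)"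
    unfolding s_def by (rule inverse_factorial_series(2)[OF Yn e(2)])
  then obtain \<rho> :: real
    where \<rho>: "0 < \<rho>" "\<rho> < 1" "(\<lambda>m. norm (s m)) \<in> O(\<lambda>m. \<rho> ^ Suc m)"
    by (elim exE conjE) (rule that)
  have "(\<lambda>m. norm (t (Suc m))) \<in> O(\<lambda>m. \<rho> ^ Suc m)"
    using \<rho>(3) e by (simp add: ts norm_mult)
  hence "(\<lambda>m. norm (t m)) \<in> O(\<lambda>m. \<rho> ^ m)" by (rule bigo_Suc_imp_bigo)
  with \<rho> show "\<exists>\<rho>::real. 0 < \<rho> \<and> \<rho> < 1 \<and> (\<lambda>m. norm (t m)) \<in> O(\<lambda>m. \<rho> ^ m)"
    by (intro exI[of _ \<rho>]) simp
qed

theorem mainTheorem1: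
  fixes x y :: complex and e :: "nat \<Rightarrow> complex"
    and a :: "nat \<Rightarrow> complex" and b :: "nat \<Rightarrow> nat \<Rightarrow> complex"
  assumes x: "x \<in> cut_plane"
    and y: "y = -\<i> * x / of_real pi"
    and e: "\<And>k. k \<ge> 1 \<Longrightarrow> e k = exp (-\<i> * of_real pi * (1 / 2 ^ k))"
    and a: "\<And>m. m \<ge> 1 \<Longrightarrow>
              a m = Gamma (of_nat m) / 2 ^ m * (1 / pochhammer y m)"
    and b: "\<And>k m. k \<ge> 1 \<Longrightarrow> m \<ge> 1 \<Longrightarrow>
              b k m = Gamma (of_nat m) * e k / (1 + e k) ^ m * (1 / pochhammer (2 ^ k * y) m)"
  shows "summable (\<lambda>m. a (Suc m)) \<and>
    (\<forall>k\<ge>1. summable (\<lambda>m. b k (Suc m))) \<and>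
    summable (\<lambda>k. \<Sum>m. b (Suc k) (Suc m)) \<and>
    exp_Ei_plus x = - (\<Sum>m. a (Suc m)) + (\<Sum>k. \<Sum>m. b (Suc k) (Suc m)) \<and>
    (\<exists>\<rho>::real. 0 < \<rho> \<and> \<rho> < 1 \<and> (\<lambda>m. norm (a m)) \<in> O(\<lambda>m. \<rho> ^ m)) \<and>
    (\<forall>k\<ge>1. \<exists>\<rho>::real. 0 < \<rho> \<and> \<rho> < 1 \<and> (\<lambda>m. norm (b k m)) \<in> O(\<lambda>m. \<rho> ^ m))"
proof -
  have "y \<in> slit_plane" unfolding y by (rule slit_plane_of_cut_plane[OF x])
  then obtain c d where c: "c > 0" "d > 0" "cball y d \<subseteq> slit_plane" "\<And>z. z \<in> cball y d \<Longrightarrow> away c c z"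
    by (rule slit_plane_locally_away) blast
  hence away: "away c c y" by simp
  have e_eq: "e (Suc k) = cnj (root_of_minus_one (Suc k))" for k
  proof -
    have "cnj (root_of_minus_one (Suc k)) = exp (\<i> * of_real (- (pi / 2 ^ Suc k)))"
      unfolding root_of_minus_one_def cis_cnj by (rule cis_conv_exp)
    thus ?thesis by (simp add: e)
  qed
  have norm_e: "norm (e (Suc k)) = 1" "norm (1 + e (Suc k)) > 1" for k
  proof -
    show "norm (e (Suc k)) = 1" by (simp add: e_eq)
    thus "norm (1 + e (Suc k)) > 1"
      by (rule norm_one_plus_gt_1) (simp add: e_eq Re_root_of_minus_one_Suc)
  qed
  \<comment> \<open>On the unit circle the inverse is the conjugate, so the Lerch parameter
    \<open>- 1 / e\<close> is the one occurring in \<open>dyadic_sum\<close>.\<close>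
  have q_eq: "- 1 / e (Suc k) = - root_of_minus_one (Suc k)" for k
  proof -
    have "- 1 / inverse w = - w" for w :: complex by (simp add: divide_inverse)
    thus ?thesis unfolding e_eq root_of_minus_one_def cis_cnj cis_inverse[symmetric] .
  qed
  \<comment> \<open>Writing 2 as \<open>1 + 1\<close> exhibits the first series as the instance
    \<open>e = 1\<close>.\<close>
  have a': "a m = Gamma (of_nat m) * 1 / (1 + 1) ^ m * (1 / pochhammer y m)" if "m \<ge> 1" for m
    using a[OF that] by (simp only: one_add_one mult_1_right)
  note A = inverse_factorial_series_eq_lerch[where e = 1 and t = a, OF _ _ away c(1,1) a']
  have B: "summable (\<lambda>m. b (Suc k) (Suc m))"
      "(\<Sum>m. b (Suc k) (Suc m)) = lerch (- root_of_minus_one (Suc k)) (2 ^ Suc k * y)"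
      "\<exists>\<rho>::real. 0 < \<rho> \<and> \<rho> < 1 \<and> (\<lambda>m. norm (b (Suc k) m)) \<in> O(\<lambda>m. \<rho> ^ m)" for k
  proof -
    have R: "2 ^ Suc k * c > 0" using c by simp
    have b': "b (Suc k) m = Gamma (of_nat m) * e (Suc k) / (1 + e (Suc k)) ^ m * (1 / pochhammer (2 ^ Suc k * y) m)"
      if "m \<ge> 1" for m
      by (rule b) (use that in auto)
    note * = inverse_factorial_series_eq_lerch[where e = "e (Suc k)" and t = "b (Suc k)",
        OF norm_e away_two_power[OF away] c(1) R b']
    show "summable (\<lambda>m. b (Suc k) (Suc m))" by (rule *)
    show "(\<Sum>m. b (Suc k) (Suc m)) = lerch (- root_of_minus_one (Suc k)) (2 ^ Suc k * y)"
      unfolding q_eq[symmetric] by (rule *)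
    show "\<exists>\<rho>::real. 0 < \<rho> \<and> \<rho> < 1 \<and> (\<lambda>m. norm (b (Suc k) m)) \<in> O(\<lambda>m. \<rho> ^ m)" by (rule *)
  qed
  have "exp_Ei_plus x = - (\<Sum>m. a (Suc m)) + (\<Sum>k. \<Sum>m. b (Suc k) (Suc m))"
    unfolding exp_Ei_plus_eq_dyadic_sum[OF x] y[symmetric] dyadic_sum_def B using A(2) by simp
  moreover have "summable (\<lambda>k. \<Sum>m. b (Suc k) (Suc m))"
    unfolding B by (rule summable_lerch_dyadic[OF away c(1,1)])
  moreover have "summable (\<lambda>m. b k (Suc m))" if "k \<ge> 1" for k
    using B(1)[of "k - 1"] that by simp
  moreover have "\<exists>\<rho>::real. 0 < \<rho> \<and> \<rho> < 1 \<and> (\<lambda>m. norm (b k m)) \<in> O(\<lambda>m. \<rho> ^ m)" if "k \<ge> 1" for k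
    using B(3)[of "k - 1"] that by simp
  moreover have "summable (\<lambda>m. a (Suc m))"
    and "\<exists>\<rho>::real. 0 < \<rho> \<and> \<rho> < 1 \<and> (\<lambda>m. norm (a m)) \<in> O(\<lambda>m. \<rho> ^ m)"
    by (rule A; simp)+
  ultimately show ?thesis by blast
qed

end
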